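(* Assume that $p$, $N$, $d$, $c$ satisfy Condition A or Condition B. Let $\varphi_c(z)=z\left(1+\sum_{n=1}^{\infty}a_n z^{-nd}\right)$ and let $\varphi_c^{-1}(z)$ be its compositional inverse, which is a formal series of the form $z\left(1+\sum_{n\ge1}a_n' z^{-nd}\right)$. Then the maximal convergent open disks (around $\infty$) of $\varphi_c(z)$ and of $\varphi_c^{-1}(z)$ are both $$D(\infty,r_N^{1/d})=\{z\in\mathbb{C}_p:|z|_p>r_N^{1/d}\},\qquad r_N=\left(|c/d^{N+1}|_p\,p^{1/(p-1)}\right)^{1/d^N}>1.$$ Moreover, $\varphi_c$ is a bijective isometry from $D(\infty,r_N^{1/d})$ onto itself.
   Context: Let $p$ be a prime, $\mathbb{C}_p$ the completion of an algebraic closure of $\mathbb{Q}_p$, $v_p$ the valuation on $\mathbb{C}_p$ with $v_p(p)=1$, and $|x|_p=p^{-v_p(x)}$. Let $d\ge2$ be an integer and $c\in\mathbb{C}_p$. Let $(a_n)_{n\ge1}$ be the unique sequence in $\mathbb{C}_p$ satisfying the formal power series identity $$\Big(1+\sum_{n\ge1}a_nx^n\Big)^d=1+cx+\sum_{n\ge1}a_nx^{nd}.$$ (Equivalently, with $x=z^{-d}$, $\varphi_c$ satisfies $f_c(\varphi_c(z))=\varphi_c(z^d)$ where $f_c(z)=z^d-c$.) Condition A: $N=0$, $d$ is a multiple of $p$, and $v_p(c)<v_p(d)+\frac{v_p((d-1)!)}{d-1}$. Condition B: $N\ge1$ is an integer, $d$ is a power of $p$, and $Nv_p(d)+\frac{v_p((d-1)!)}{d-1}<v_p(c)<(N+1)v_p(d)+\frac{v_p((d-1)!)}{d-1}$.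 For a series $z\left(1+\sum_n \gamma_n z^{-nd}\right)$, its maximal convergent open disk is the largest set $D(\infty,\rho)=\{|z|_p>\rho\}$ on which it converges, i.e. $\rho^d=\limsup_n|\gamma_n|_p^{1/n}$. *)

theory Defs
  imports "HOL-Analysis.Analysis" "HOL-Computational_Algebra.Polynomial"
          "HOL-Computational_Algebra.Formal_Power_Series"
begin

definition Cp_like :: "nat \<Rightarrow> ('a::field_char_0 \<Rightarrow> real) \<Rightarrow> bool" where
  "Cp_like p absv \<longleftrightarrow>
     prime p \<and>
     (\<forall>x. absv x \<ge> 0) \<and> (\<forall>x. absv x = 0 \<longleftrightarrow> x = 0) \<and>
     (\<forall>x y. absv (x * y) = absv x * absv y) \<and>
     (\<forall>x y. absv (x + y) \<le> max (absv x) (absv y)) \<and>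
     absv (of_nat p) = 1 / real p \<and>
     (\<forall>X::nat \<Rightarrow> 'a. (\<forall>e>0. \<exists>M. \<forall>m\<ge>M. \<forall>n\<ge>M. absv (X m - X n) < e) \<longrightarrow>
        (\<exists>L. (\<lambda>n. absv (X n - L)) \<longlonglongrightarrow> 0)) \<and>
     (\<forall>q::'a poly. degree q \<ge> 1 \<longrightarrow> (\<exists>x. poly q x = 0))"

definition vp :: "nat \<Rightarrow> ('a::field \<Rightarrow> real) \<Rightarrow> 'a \<Rightarrow> ereal" where
  "vp p absv x = (if x = 0 then \<infinity> else ereal (- log (real p) (absv x)))"

definition abs_sums :: "('a::field \<Rightarrow> real) \<Rightarrow> (nat \<Rightarrow> 'a) \<Rightarrow> 'a \<Rightarrow> bool" where
  "abs_sums absv f s \<longleftrightarrow> (\<lambda>n. absv ((\<Sum>i<n. f i) - s)) \<longlonglongrightarrow> 0"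

definition lac_fps :: "nat \<Rightarrow> (nat \<Rightarrow> 'a::field) \<Rightarrow> 'a fps" where
  "lac_fps d a = Abs_fps (\<lambda>m. if m = 0 then 1 else if d dvd m then a (m div d) else 0)"

definition bottcher_coeffs :: "nat \<Rightarrow> 'a::field \<Rightarrow> (nat \<Rightarrow> 'a) \<Rightarrow> bool" where
  "bottcher_coeffs d c a \<longleftrightarrow>
     (lac_fps 1 a) ^ d = lac_fps d a + fps_const c * fps_X"

text \<open>a' are the coefficients of the compositional inverse of
  phi(z) = z (1 + sum a_n z^(-nd)), i.e. psi(z) = z (1 + sum a'_n z^(-nd)) with
  psi(phi(z)) = z.  With u = 1/z, P = lac_fps d a, Q = lac_fps d a', this reads
  P(u) * Q(u / P(u)) = 1 formally.\<close>
definition inverse_coeffs :: "nat \<Rightarrow> (nat \<Rightarrow> 'a::field) \<Rightarrow> (nat \<Rightarrow> 'a) \<Rightarrow> bool" where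
  "inverse_coeffs d a a' \<longleftrightarrow>
     lac_fps d a * fps_compose (lac_fps d a') (fps_X * inverse (lac_fps d a)) = 1"

definition disk_inf :: "('a \<Rightarrow> real) \<Rightarrow> real \<Rightarrow> 'a set" where
  "disk_inf absv \<rho> = {z. absv z > \<rho>}"

text \<open>The d-th power of the radius of the maximal convergent disk of
  z(1 + sum gamma_n z^(-nd)): limsup |gamma_n|^(1/n).\<close>
definition radius_pow :: "('a \<Rightarrow> real) \<Rightarrow> (nat \<Rightarrow> 'a) \<Rightarrow> ereal" where
  "radius_pow absv \<gamma> = limsup (\<lambda>n. ereal (absv (\<gamma> n) powr (1 / real n)))"

end

theory Submission
  imports Defs
begin

text \<open>
  Write \<open>F = 1 + \<Sum> a\<^sub>n x\<^sup>n\<close>, so that \<open>F\<^sup>d = 1 + H\<close> with \<open>H = c x + \<Sum> a\<^sub>n x\<^sup>n\<^sup>d\<close> and hence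
  \<open>F = \<Sum> binom(1/d, k) H\<^sup>k\<close>.  Since \<open>p\<close> divides \<open>d\<close>, \<open>\<bar>binom(1/d, k)\<bar> = 1 / (\<bar>d\<bar>\<^sup>k \<bar>k!\<bar>)\<close>.  With
  \<open>\<epsilon> = p\<^bsup>-1/(p-1)\<^esup>\<close> and \<open>E = \<bar>d\<bar> \<epsilon>\<close>, Legendre's formula gives \<open>\<bar>binom(1/d, k)\<bar> E\<^sup>k \<le> \<epsilon>\<close>, with equality
  if \<open>k\<close> is a power of \<open>p\<close>.  Both conditions on \<open>c\<close> say that on the circle of radius \<open>1/r\<close> the series
  \<open>H\<close> has Gauss norm \<open>E\<close>, attained only by its term of degree \<open>d\<^sup>N\<close>, which has size \<open>\<bar>c/d\<^sup>N\<bar>\<close>; the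
  two inequalities compare this term with those of degrees \<open>d\<^bsup>N-1\<^esup>\<close> and \<open>d\<^bsup>N+1\<^esup>\<close>.  Therefore
  \<open>\<bar>a\<^sub>n\<bar> \<le> \<epsilon> r\<^sup>n\<close> for all \<open>n\<close>, with equality for \<open>n = p\<^sup>j d\<^sup>N\<close>.

  As \<open>\<epsilon> < 1\<close>, this bound makes \<open>\<phi>\<^sub>c\<close> differ from the identity by a contraction, hence an isometric
  bijection.  Bounds of the form \<open>\<bar>a\<^sub>n\<bar> \<le> C t\<^sup>n\<close> with \<open>C \<le> 1\<close> pass to the inverse series and back, so a
  radius of \<open>\<phi>\<^sub>c\<^sup>-\<^sup>1\<close> below \<open>r\<close> would contradict these equality cases.
\<close>

subsection \<open>Ultrametric absolute values\<close>

locale nonarch_abs =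
  fixes absv :: "'a::field \<Rightarrow> real"
  assumes nonneg [simp]: "0 \<le> absv x"
    and eq_0 [simp]: "absv x = 0 \<longleftrightarrow> x = 0"
    and mult: "absv (x * y) = absv x * absv y"
    and ultra: "absv (x + y) \<le> max (absv x) (absv y)"
begin

lemma pos_iff [simp]: "0 < absv x \<longleftrightarrow> x \<noteq> 0"
  using nonneg[of x] eq_0[of x] by linarith

lemma zero [simp]: "absv 0 = 0"
  by simp

lemma one [simp]: "absv 1 = 1"
proof -
  have "absv 1 * absv 1 = absv 1 * 1" using mult[of 1 1] by simp
  thus ?thesis by (metis eq_0 mult_cancel_left zero_neq_one)
qed

lemma minus [simp]: "absv (- x) = absv x"
proof -
  have "absv (-1) * absv (-1) = 1" using mult[of "-1" "-1"] by simp
  hence "absv (-1) = 1" using nonneg[of "-1"]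
    by (metis abs_of_nonneg abs_square_eq_1 power2_eq_square)
  thus ?thesis using mult[of "-1" x] by simp
qed

lemma minus_commute: "absv (x - y) = absv (y - x)"
  using minus[of "x - y"] by simp

lemma ultra_diff: "absv (x - y) \<le> max (absv x) (absv y)"
  using ultra[of x "- y"] by simp

lemma power: "absv (x ^ n) = absv x ^ n"
  by (induction n) (simp_all add: mult)

lemma inverse: "absv (inverse x) = inverse (absv x)"
proof (cases "x = 0")
  case False
  have "absv x * absv (inverse x) = 1" using mult[of x "inverse x"] False by simp
  thus ?thesis by (metis inverse_unique)
qed simp

lemma divide: "absv (x / y) = absv x / absv y"
  by (simp add: divide_inverse mult inverse)

text \<open>Writing \<open>x\<close> as \<open>(x + y) - y\<close> bounds \<open>absv x\<close> by
  the maximum of \<open>absv (x + y)\<close> and \<open>absv y\<close>, and \<open>absv y\<close> is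
  too small to be that maximum.\<close>

lemma add_dominant:
  assumes "absv y < absv x"
  shows "absv (x + y) = absv x"
proof -
  have "absv x \<le> max (absv (x + y)) (absv y)" using ultra_diff[of "x + y" y] by simp
  thus ?thesis using ultra[of x y] assms by linarith
qed

lemma sum_le:
  assumes "0 \<le> B" "\<And>i. i \<in> S \<Longrightarrow> absv (f i) \<le> B"
  shows "absv (sum f S) \<le> B"
  using assms
proof (induction S rule: infinite_finite_induct)
  case (insert x F)
  thus ?case using ultra[of "f x" "sum f F"] by force
qed auto

lemma sum_less:
  assumes "0 < B" "\<And>i. i \<in> S \<Longrightarrow> absv (f i) < B"
  shows "absv (sum f S) < B"
  using assms
proof (induction S rule: infinite_finite_induct)
  case (insert x F)
  have "absv (f x) < B" "absv (sum f F) < B" using insert by auto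
  thus ?case using ultra[of "f x" "sum f F"] insert(1,2) by force
qed auto

lemma sum_dominant:
  assumes "finite S" "j \<in> S" "0 < B" "absv (f j) = B"
    "\<And>i. i \<in> S \<Longrightarrow> i \<noteq> j \<Longrightarrow> absv (f i) < B"
  shows "absv (sum f S) = B"
proof -
  have "absv (sum f (S - {j})) < B" using assms by (intro sum_less) auto
  thus ?thesis using assms add_dominant[of "sum f (S - {j})" "f j"] by (simp add: sum.remove)
qed

lemma of_nat_le_1: "absv (of_nat n) \<le> 1"
  using sum_le[of 1 "{..<n}" "\<lambda>_. 1"] by simp

lemma of_int_le_1: "absv (of_int n) \<le> 1"
  by (cases n rule: int_cases2) (simp_all add: of_nat_le_1)

text \<open>Coefficient bounds \<open>\<bar>f\<^sub>i\<bar> \<le> C t\<^sup>i\<close> are Gauss norm bounds, stated for truncations so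
  that they can be used inside inductions over the coefficients.\<close>

lemma fps_mult_bound:
  assumes "0 \<le> C" "0 \<le> D" "0 \<le> t"
    and f: "\<And>i. i \<le> n \<Longrightarrow> absv (fps_nth f i) \<le> C * t ^ i"
    and g: "\<And>i. i \<le> n \<Longrightarrow> absv (fps_nth g i) \<le> D * t ^ i"
    and m: "m \<le> n"
  shows "absv (fps_nth (f * g) m) \<le> C * D * t ^ m"
  unfolding fps_mult_nth
proof (rule sum_le)
  fix i assume i: "i \<in> {0..m}"
  have "absv (fps_nth f i * fps_nth g (m - i)) \<le> (C * t ^ i) * (D * t ^ (m - i))"
    unfolding mult using i m assms(1-3) by (intro mult_mono f g) auto
  also have "\<dots> = C * D * t ^ m" using i by (simp flip: power_add)
  finally show "absv (fps_nth f i * fps_nth g (m - i)) \<le> C * D * t ^ m" .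
qed (use assms(1-3) in auto)

lemma fps_power_bound:
  assumes "0 \<le> C" "0 \<le> t"
    and f: "\<And>i. i \<le> n \<Longrightarrow> absv (fps_nth f i) \<le> C * t ^ i"
    and m: "m \<le> n"
  shows "absv (fps_nth (f ^ k) m) \<le> C ^ k * t ^ m"
  using m
proof (induction k arbitrary: m)
  case 0
  thus ?case using assms by (simp add: fps_one_def)
next
  case (Suc k)
  have "absv (fps_nth (f * f ^ k) m) \<le> C * C ^ k * t ^ m"
    by (rule fps_mult_bound[where n = n]) (use assms Suc in auto)
  thus ?case by simp
qed

text \<open>For positive \<open>t\<close>: on the circle of radius \<open>1/t\<close> the Gauss norm
  of \<open>f\<close> is \<open>C\<close>, attained by the term of degree \<open>a\<close> alone.
  Pointwise strictness suffices, since every coefficient of a product is a finite sum.\<close>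

definition gauss_dominant :: "real \<Rightarrow> real \<Rightarrow> nat \<Rightarrow> 'a fps \<Rightarrow> bool" where
  "gauss_dominant C t a f \<longleftrightarrow>
     absv (fps_nth f a) = C * t ^ a \<and> (\<forall>i. i \<noteq> a \<longrightarrow> absv (fps_nth f i) < C * t ^ i)"

text \<open>A pair of degrees other than \<open>(a, b)\<close> has a strict factor. Hence one
  summand beats the rest in degree \<open>a + b\<close>, and none reaches the bound
  elsewhere.\<close>

lemma gauss_dominant_mult:
  assumes "0 < C" "0 < D" "0 < t" "gauss_dominant C t a f" "gauss_dominant D t b g"
  shows "gauss_dominant (C * D) t (a + b) (f * g)"
proof -
  have le: "absv (fps_nth f i) \<le> C * t ^ i" "absv (fps_nth g i) \<le> D * t ^ i" for i
    using assms(4,5) unfolding gauss_dominant_def by (metis order.order_iff_strict)+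
  have lt: "absv (fps_nth f i * fps_nth g (m - i)) < C * D * t ^ m"
    if i: "i \<in> {0..m}" and ne: "i \<noteq> a \<or> m - i \<noteq> b" for m i
  proof -
    have "absv (fps_nth f i * fps_nth g (m - i)) < (C * t ^ i) * (D * t ^ (m - i))"
    proof (cases "i = a")
      case True
      thus ?thesis unfolding mult using assms ne
        by (intro mult_le_less_imp_less le) (auto simp: gauss_dominant_def)
    next
      case False
      \<comment> \<open>The coefficient of \<open>g\<close> may vanish, so it is replaced by its
        positive bound before strictness of the first factor is used.\<close>
      have "absv (fps_nth f i) * absv (fps_nth g (m - i)) \<le> absv (fps_nth f i) * (D * t ^ (m - i))"
        by (intro mult_left_mono le) auto
      also have "\<dots> < (C * t ^ i) * (D * t ^ (m - i))"
        using False assms by (intro mult_strict_right_mono) (auto simp: gauss_dominant_def)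
      finally show ?thesis unfolding mult .
    qed
    also have "\<dots> = C * D * t ^ m" using i by (simp flip: power_add)
    finally show ?thesis .
  qed
  have "absv (fps_nth (f * g) (a + b)) = C * D * t ^ (a + b)"
    unfolding fps_mult_nth
  proof (rule sum_dominant[where j = a])
    show "absv (fps_nth f a * fps_nth g (a + b - a)) = C * D * t ^ (a + b)"
      using assms by (simp add: gauss_dominant_def mult power_add)
  qed (use assms in \<open>auto intro!: lt\<close>)
  moreover have "absv (fps_nth (f * g) m) < C * D * t ^ m" if "m \<noteq> a + b" for m
    unfolding fps_mult_nth by (rule sum_less) (use that assms in \<open>auto intro!: lt\<close>)
  ultimately show ?thesis by (simp add: gauss_dominant_def)
qed

lemma gauss_dominant_power:
  assumes "0 < C" "0 < t" "gauss_dominant C t a f"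
  shows "gauss_dominant (C ^ k) t (k * a) (f ^ k)"
proof (induction k)
  case 0
  show ?case using assms by (simp add: gauss_dominant_def)
next
  case (Suc k)
  thus ?case using gauss_dominant_mult[OF assms(1) _ assms(2,3) Suc] assms by simp
qed

text \<open>The two end terms of the convolution carry a factor 1, the inner ones
  \<open>C * C\<close>, which is at most \<open>C\<close>. The same absorption gives closure under
  powers and inverses below.\<close>

lemma fps_one_plus_mult_bound:
  assumes C: "0 \<le> C" "C \<le> 1" "0 \<le> t"
    and f: "fps_nth f 0 = 1" "\<And>i. 0 < i \<Longrightarrow> i \<le> n \<Longrightarrow> absv (fps_nth f i) \<le> C * t ^ i"
    and g: "fps_nth g 0 = 1" "\<And>i. 0 < i \<Longrightarrow> i \<le> n \<Longrightarrow> absv (fps_nth g i) \<le> C * t ^ i"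
    and m: "0 < m" "m \<le> n"
  shows "absv (fps_nth (f * g) m) \<le> C * t ^ m"
  unfolding fps_mult_nth
proof (rule sum_le)
  fix i assume i: "i \<in> {0..m}"
  consider "i = 0" | "i = m" | "0 < i" "i < m" using i by force
  thus "absv (fps_nth f i * fps_nth g (m - i)) \<le> C * t ^ m"
  proof cases
    case 3
    have "absv (fps_nth f i * fps_nth g (m - i)) \<le> (C * t ^ i) * (C * t ^ (m - i))"
      unfolding mult using 3 m C by (intro mult_mono f g) auto
    also have "\<dots> = C * C * t ^ m" using i by (simp flip: power_add)
    also have "\<dots> \<le> C * t ^ m" using C by (simp add: mult_left_le mult_right_mono)
    finally show ?thesis .
  qed (use f g m in auto)
qed (use C in auto)

lemma fps_one_plus_power_bound:
  assumes C: "0 \<le> C" "C \<le> 1" "0 \<le> t"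
    and f: "fps_nth f 0 = 1" "\<And>i. 0 < i \<Longrightarrow> i \<le> n \<Longrightarrow> absv (fps_nth f i) \<le> C * t ^ i"
    and m: "0 < m" "m \<le> n"
  shows "absv (fps_nth (f ^ k) m) \<le> C * t ^ m"
  using m
proof (induction k arbitrary: m)
  case 0
  thus ?case using C by simp
next
  case (Suc k)
  have "absv (fps_nth (f * f ^ k) m) \<le> C * t ^ m"
    by (rule fps_one_plus_mult_bound[where n = n])
      (use assms Suc in \<open>auto simp: fps_power_zeroth\<close>)
  thus ?case by simp
qed

lemma fps_one_plus_inverse_bound:
  assumes C: "0 \<le> C" "C \<le> 1" "0 \<le> t"
    and f: "fps_nth f 0 = 1" "\<And>i. 0 < i \<Longrightarrow> i \<le> n \<Longrightarrow> absv (fps_nth f i) \<le> C * t ^ i"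
    and m: "0 < m" "m \<le> n"
  shows "absv (fps_nth (inverse f) m) \<le> C * t ^ m"
  using m
proof (induction m rule: less_induct)
  case (less m)
  let ?g = "inverse f"
  have "fps_nth (f * ?g) m = 0" using f less.prems inverse_mult_eq_1'[of f] by simp
  hence "fps_nth ?g m = - (\<Sum>i\<in>{1..m}. fps_nth f i * fps_nth ?g (m - i))"
    using f by (simp add: fps_mult_nth sum.atLeast_Suc_atMost eq_neg_iff_add_eq_0)
  also have "absv \<dots> \<le> C * t ^ m"
    unfolding minus
  proof (rule sum_le)
    fix i assume i: "i \<in> {1..m}"
    show "absv (fps_nth f i * fps_nth ?g (m - i)) \<le> C * t ^ m"
    proof (cases "i = m")
      case False
      have "absv (fps_nth f i * fps_nth ?g (m - i)) \<le> (C * t ^ i) * (C * t ^ (m - i))"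
        unfolding mult using False i less.prems C by (intro mult_mono f less.IH) auto
      also have "\<dots> = C * C * t ^ m" using i by (simp flip: power_add)
      also have "\<dots> \<le> C * t ^ m" using C by (simp add: mult_left_le mult_right_mono)
      finally show ?thesis .
    qed (use f less.prems in auto)
  qed (use C in auto)
  finally show ?case .
qed

end

subsection \<open>Legendre's formula\<close>

text \<open>Only the multiples of \<open>p\<close> up to \<open>k\<close> contribute, and dividing
  each of them by \<open>p\<close> leaves \<open>fact (k div p)\<close>.\<close>

lemma multiplicity_fact_div:
  assumes "prime (p::nat)"
  shows "multiplicity p (fact k) = k div p + multiplicity p (fact (k div p))"
proof (induction k)
  case (Suc k)
  have mult: "multiplicity p (m * n) = multiplicity p m + multiplicity p n"
    if "m > 0" "n > 0" for m n :: nat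
    using assms that by (intro prime_elem_multiplicity_mult_distrib) auto
  have *: "multiplicity p (fact (Suc k)) = multiplicity p (Suc k) + multiplicity p (fact k)"
    unfolding fact_Suc of_nat_id by (rule mult) simp_all
  show ?case
  proof (cases "p dvd Suc k")
    case True
    then obtain m where m: "Suc k = p * m" by blast
    have p: "p > 1" using assms prime_gt_1_nat by blast
    with m obtain m' where m': "m = Suc m'" by (cases m) auto
    have k: "k = p * m' + (p - 1)" using m m' p by simp
    have "k div p = m'" unfolding k using p by (simp only: div_mult_self4) simp
    moreover have "Suc k div p = m" unfolding m using p by simp
    moreover have "multiplicity p (Suc k) = Suc (multiplicity p m)"
      unfolding m using p m' assms by (subst mult) (auto simp: multiplicity_self)
    moreover have "multiplicity p (fact m) = multiplicity p m + multiplicity p (fact m')"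
      unfolding m' fact_Suc of_nat_id by (rule mult) simp_all
    ultimately show ?thesis unfolding * using Suc m' by simp
  next
    case False
    hence "Suc k div p = k div p" by (simp add: div_Suc dvd_eq_mod_eq_0)
    thus ?thesis unfolding * using False Suc by (simp add: not_dvd_imp_multiplicity_0)
  qed
qed simp

text \<open>Legendre's formula reads \<open>(k - s) / (p - 1)\<close> with \<open>s\<close> the
  digit sum of \<open>k\<close> in base \<open>p\<close>. Here \<open>s \<ge> 1\<close> is used, and
  for powers of \<open>p\<close> below \<open>s = 1\<close>.\<close>

lemma multiplicity_fact_le:
  assumes "prime (p::nat)" "k > 0"
  shows "multiplicity p (fact k) * (p - 1) \<le> k - 1"
  using assms(2)
proof (induction k rule: less_induct)
  case (less k)
  have p: "p > 1" using assms prime_gt_1_nat by blast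
  define q where "q = k div p"
  have eq: "multiplicity p (fact k) = q + multiplicity p (fact q)"
    unfolding q_def by (rule multiplicity_fact_div[OF assms(1)])
  show ?case
  proof (cases "q = 0")
    case False
    have "q < k" using less.prems p by (simp add: q_def)
    hence IH: "multiplicity p (fact q) * (p - 1) \<le> q - 1" using less.IH False by simp
    have "p * q \<le> k" by (simp add: q_def)
    moreover have "q * (p - 1) + q = p * q" using p by (cases p) auto
    ultimately show ?thesis unfolding eq add_mult_distrib using IH False by linarith
  qed (use eq in simp)
qed

lemma multiplicity_fact_prime_power:
  assumes "prime (p::nat)"
  shows "multiplicity p (fact (p ^ j)) * (p - 1) = p ^ j - 1"
proof (induction j)
  case (Suc j)
  have p: "p > 1" using assms prime_gt_1_nat by blast
  have "multiplicity p (fact (p ^ Suc j)) = p ^ j + multiplicity p (fact (p ^ j))"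
    using multiplicity_fact_div[OF assms, of "p ^ Suc j"] p by simp
  hence "multiplicity p (fact (p ^ Suc j)) * (p - 1) = p ^ j * (p - 1) + (p ^ j - 1)"
    using Suc by (simp add: add_mult_distrib)
  moreover have "p ^ j * (p - 1) + p ^ j = p ^ Suc j" using p by (cases p) auto
  moreover have "p ^ j > 0" using p by simp
  ultimately show ?case by linarith
qed simp

subsection \<open>Binomial series over \<open>p\<close>-adic fields\<close>

locale padic_abs = nonarch_abs absv for absv :: "'a::field_char_0 \<Rightarrow> real" +
  fixes p :: nat
  assumes prime_p: "prime p" and abs_p: "absv (of_nat p) = 1 / real p"
begin

lemma p_gt_1: "p > 1"
  using prime_p prime_gt_1_nat by blast

text \<open>In a Bezout relation \<open>u n + w p = 1\<close> the second term has size below 1, so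
  the first must have size at least 1.\<close>

lemma abs_of_nat_coprime:
  assumes "\<not> p dvd n"
  shows "absv (of_nat n) = 1"
proof (rule antisym[OF of_nat_le_1])
  have "coprime (int n) (int p)" using prime_p assms
    by (metis coprime_commute coprime_int_iff prime_imp_coprime)
  then obtain u w where "u * int n + w * int p = 1"
    using bezout_int[of "int n" "int p"] by auto
  hence "(1::'a) = of_int (u * int n + w * int p)" by simp
  hence "1 = absv (of_int u * of_nat n + of_int w * of_nat p :: 'a)" by simp
  also have "\<dots> \<le> max (absv (of_int u * of_nat n)) (absv (of_int w * of_nat p))"
    by (rule ultra)
  also have "\<dots> \<le> max (absv (of_nat n)) (1 / real p)"
    unfolding mult abs_p using of_int_le_1 p_gt_1
    by (intro max.mono mult_left_le_one_le) (auto intro: mult_left_le_one_le)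
  finally show "1 \<le> absv (of_nat n :: 'a)" using p_gt_1 by (simp add: le_max_iff_disj)
qed

lemma abs_of_nat:
  assumes "n > 0"
  shows "absv (of_nat n) = real p powr - real (multiplicity p n)"
proof -
  obtain m where m: "n = p ^ multiplicity p n * m" "\<not> p dvd m"
    using multiplicity_decompose'[of n p] assms p_gt_1 by auto
  have "absv (of_nat n :: 'a) = absv (of_nat p ^ multiplicity p n * of_nat m)"
    by (metis m(1) of_nat_mult of_nat_power)
  also have "\<dots> = (1 / real p) ^ multiplicity p n"
    using m(2) by (simp add: mult power abs_p abs_of_nat_coprime)
  also have "\<dots> = real p powr - real (multiplicity p n)"
    using p_gt_1 by (simp add: powr_minus powr_realpow power_one_over inverse_eq_divide)
  finally show ?thesis .
qed

text \<open>The radius of convergence of the \<open>p\<close>-adic exponential series.\<close>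

definition eps :: real where "eps = real p powr (- 1 / (real p - 1))"

lemma eps_power: "eps ^ k = real p powr (real k * (- 1 / (real p - 1)))"
  unfolding eps_def using p_gt_1 by (subst powr_power) (auto simp: mult.commute)

lemma eps_pos: "eps > 0"
  using p_gt_1 by (simp add: eps_def)

lemma eps_less_1: "eps < 1"
  unfolding eps_def using p_gt_1 by (simp add: powr_less_one)

lemma abs_fact: "absv (fact k) = real p powr - real (multiplicity p (fact k))"
  using abs_of_nat[of "fact k"] by simp

text \<open>By Legendre's formula the quotient is \<open>eps ^ s\<close> with
  \<open>s \<ge> 1\<close> the digit sum of \<open>k\<close> in base \<open>p\<close>.\<close>

lemma eps_power_div_fact_le:
  assumes "k > 0"
  shows "eps ^ k / absv (fact k) \<le> eps"
proof -
  have "real (multiplicity p (fact k) * (p - 1)) \<le> real (k - 1)"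
    using multiplicity_fact_le[OF prime_p assms] of_nat_le_iff by blast
  hence le: "real (multiplicity p (fact k)) \<le> (real k - 1) / (real p - 1)"
    using assms p_gt_1 by (simp add: of_nat_diff pos_le_divide_eq)
  have "eps ^ k / absv (fact k)
      = real p powr (real k * (- 1 / (real p - 1)) + real (multiplicity p (fact k)))"
    unfolding eps_power abs_fact powr_add powr_minus by (simp add: divide_inverse)
  also have "\<dots> \<le> real p powr (- 1 / (real p - 1))"
    using le p_gt_1 by (intro powr_mono) (auto simp: divide_simps)
  finally show ?thesis by (simp add: eps_def)
qed

lemma eps_power_div_fact_eq: "eps ^ (p ^ j) / absv (fact (p ^ j)) = eps"
proof -
  have "real (multiplicity p (fact (p ^ j)) * (p - 1)) = real (p ^ j - 1)"
    using multiplicity_fact_prime_power[OF prime_p] by simp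
  hence eq: "real (multiplicity p (fact (p ^ j))) = (real (p ^ j) - 1) / (real p - 1)"
    using p_gt_1 by (simp add: of_nat_diff eq_divide_eq)
  have "eps ^ (p ^ j) / absv (fact (p ^ j))
      = real p powr (real (p ^ j) * (- 1 / (real p - 1)) + real (multiplicity p (fact (p ^ j))))"
    unfolding eps_power abs_fact powr_add powr_minus by (simp add: divide_inverse)
  also have "\<dots> = real p powr (- 1 / (real p - 1))"
    unfolding eq by (intro arg_cong[of _ _ "\<lambda>x. real p powr x"]) (simp add: diff_divide_distrib)
  finally show ?thesis by (simp add: eps_def)
qed

lemma abs_dvd_less_1:
  assumes "p dvd n" "n > 0"
  shows "absv (of_nat n) < 1"
proof -
  have "0 < multiplicity p n" using assms p_gt_1 prime_p
    by (simp add: prime_multiplicity_gt_zero_iff prime_imp_prime_elem)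
  thus ?thesis unfolding abs_of_nat[OF assms(2)] using p_gt_1 by (simp add: powr_less_one)
qed

text \<open>Since \<open>p\<close> divides \<open>d\<close>, the number \<open>1 / d\<close> has
  size above 1 and dominates each integer \<open>i\<close> in the factors
  \<open>1 / d - i\<close>.\<close>

lemma abs_gbinomial_inverse:
  assumes "p dvd d" "d > 0"
  shows "absv ((1 / of_nat d) gchoose k) = 1 / (absv (of_nat d) ^ k * absv (fact k))"
proof -
  have pos: "absv (of_nat d) > 0" using assms by simp
  have *: "absv (1 / of_nat d - of_nat i) = 1 / absv (of_nat d)" for i
  proof -
    have "absv (- of_nat i) < absv (1 / of_nat d)"
      using of_nat_le_1[of i] less_divide_eq_1_pos[OF pos, of 1] abs_dvd_less_1[OF assms]
      by (simp add: divide)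
    thus ?thesis using add_dominant[of "- of_nat i" "1 / of_nat d"] by (simp add: divide)
  qed
  have "absv (\<Prod>i = 0..<k. 1 / of_nat d - of_nat i) = (1 / absv (of_nat d)) ^ k"
    by (induction k) (simp_all add: mult *)
  moreover have "(1 / of_nat d) gchoose k = (\<Prod>i = 0..<k. 1 / of_nat d - of_nat i :: 'a) / fact k"
    using gbinomial_mult_fact'[of "1 / of_nat d :: 'a" k] by (simp add: field_simps)
  ultimately show ?thesis by (simp add: divide power_one_over)
qed

end

text \<open>Both sides are \<open>d\<close>-th roots of \<open>1 + H\<close> with constant term 1.
  The cofactor of \<open>F - G\<close> in \<open>F ^ d - G ^ d\<close> has constant term
  \<open>d\<close>, which is nonzero, so the roots agree.\<close>

lemma fps_root_eq_binomial_compose: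
  fixes F H :: "'a::field_char_0 fps"
  assumes F: "F ^ d = 1 + H" "fps_nth F 0 = 1" and d: "d > 0" and H: "fps_nth H 0 = 0"
  shows "F = fps_compose (fps_binomial (1 / of_nat d)) H"
proof -
  define G where "G = fps_compose (fps_binomial (1 / of_nat d)) H"
  have "G ^ d = fps_compose (fps_binomial (1 / of_nat d) ^ d) H"
    unfolding G_def using H by (rule fps_compose_power)
  also have "\<dots> = 1 + H"
    using d by (simp add: fps_binomial_power fps_binomial_1 fps_compose_add_distrib H)
  finally have "F ^ d - G ^ d = 0" using F by simp
  hence "(F - G) * (\<Sum>i<d. G ^ (d - Suc i) * F ^ i) = 0"
    by (subst (asm) power_diff_sumr2) simp
  moreover have "fps_nth (\<Sum>i<d. G ^ (d - Suc i) * F ^ i) 0 = of_nat d"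
    using F by (simp add: fps_sum_nth fps_power_zeroth G_def)
  hence "(\<Sum>i<d. G ^ (d - Suc i) * F ^ i) \<noteq> 0" using d by auto
  ultimately show ?thesis by (simp add: G_def)
qed

lemma fps_root_nth:
  fixes F H :: "'a::field_char_0 fps"
  assumes "F ^ d = 1 + H" "fps_nth F 0 = 1" "d > 0" "fps_nth H 0 = 0"
  shows "fps_nth F n = (\<Sum>k = 0..n. ((1 / of_nat d) gchoose k) * fps_nth (H ^ k) n)"
  by (subst fps_root_eq_binomial_compose[OF assms]) (simp add: fps_compose_nth)

section \<open>Sizes of the coefficients of a \<open>d\<close>-th root\<close>

context padic_abs
begin

lemma abs_gbinomial_inverse_le:
  assumes d: "p dvd d" "d > 0" and k: "k > 0"
  shows "absv ((1 / of_nat d) gchoose k) * (absv (of_nat d) * eps) ^ k \<le> eps"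
  using eps_power_div_fact_le[OF k] d
  by (simp add: abs_gbinomial_inverse power_mult_distrib)

text \<open>The \<open>k\<close>-th term of the binomial expansion is at most
  \<open>eps * C ^ k * t ^ n\<close>. Splitting off the linear term \<open>H / d\<close> leaves only
  \<open>k \<ge> 2\<close>, whence the square of \<open>C\<close>.\<close>

lemma abs_root_nth_le:
  assumes F: "F ^ d = 1 + H" "fps_nth F 0 = 1" "fps_nth H 0 = 0"
    and d: "p dvd d" "d > 0" and C: "0 \<le> C" "C \<le> 1" "0 \<le> t" and n: "n > 0"
    and H: "\<And>i. i \<le> n \<Longrightarrow> absv (fps_nth H i) \<le> absv (of_nat d) * eps * C * t ^ i"
  shows "absv (fps_nth F n) \<le> eps * C * t ^ n"
    and "absv (fps_nth F n - fps_nth H n / of_nat d) \<le> eps * C\<^sup>2 * t ^ n"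
proof -
  define g where "g k = ((1 / of_nat d) gchoose k) * fps_nth (H ^ k) n" for k
  have F_eq: "fps_nth F n = (\<Sum>k\<in>{1..n}. g k)"
    unfolding g_def fps_root_nth[OF F(1,2) d(2) F(3)]
    using n by (subst sum.atLeast_Suc_atMost) auto
  have g: "absv (g k) \<le> eps * C ^ k * t ^ n" if "k > 0" for k
  proof -
    let ?b = "absv ((1 / of_nat d) gchoose k)"
    have "absv (g k) \<le> ?b * ((absv (of_nat d) * eps * C) ^ k * t ^ n)"
      unfolding g_def mult using C eps_pos
      by (intro mult_left_mono fps_power_bound[where n = n]) (auto intro: H)
    also have "\<dots> = (?b * (absv (of_nat d) * eps) ^ k) * (C ^ k * t ^ n)"
      by (simp add: power_mult_distrib)
    also have "\<dots> \<le> eps * (C ^ k * t ^ n)"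
      using C by (intro mult_right_mono abs_gbinomial_inverse_le d that) auto
    finally show ?thesis by simp
  qed
  show "absv (fps_nth F n) \<le> eps * C * t ^ n"
    unfolding F_eq
  proof (rule sum_le)
    fix k assume "k \<in> {1..n}"
    hence "C ^ k \<le> C ^ 1" using C by (intro power_decreasing) auto
    hence "eps * C ^ k * t ^ n \<le> eps * C * t ^ n"
      using C eps_pos by (intro mult_right_mono mult_left_mono) auto
    thus "absv (g k) \<le> eps * C * t ^ n" using g[of k] \<open>k \<in> {1..n}\<close> by simp
  qed (use C eps_pos in auto)
  have "fps_nth F n - fps_nth H n / of_nat d = (\<Sum>k\<in>{2..n}. g k)"
    unfolding F_eq using n by (simp add: sum.atLeast_Suc_atMost g_def numeral_2_eq_2)
  also have "absv \<dots> \<le> eps * C\<^sup>2 * t ^ n"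
  proof (rule sum_le)
    fix k assume "k \<in> {2..n}"
    hence "C ^ k \<le> C ^ 2" using C by (intro power_decreasing) auto
    hence "eps * C ^ k * t ^ n \<le> eps * C\<^sup>2 * t ^ n"
      using C eps_pos by (intro mult_right_mono mult_left_mono) auto
    thus "absv (g k) \<le> eps * C\<^sup>2 * t ^ n" using g[of k] \<open>k \<in> {2..n}\<close> by simp
  qed (use C eps_pos in auto)
  finally show "absv (fps_nth F n - fps_nth H n / of_nat d) \<le> eps * C\<^sup>2 * t ^ n" .
qed

text \<open>In degree \<open>p ^ j * m\<close> the power \<open>H ^ k\<close> attains its Gauss norm
  only for \<open>k = p ^ j\<close>, and there the binomial coefficient is extremal too.\<close>

lemma abs_root_nth_eq:
  assumes F: "F ^ d = 1 + H" "fps_nth F 0 = 1" "fps_nth H 0 = 0"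
    and d: "p dvd d" "d > 0" and t: "0 < t" and m: "0 < m"
    and H: "gauss_dominant (absv (of_nat d) * eps) t m H"
  shows "absv (fps_nth F (p ^ j * m)) = eps * t ^ (p ^ j * m)"
proof -
  define n where "n = p ^ j * m"
  define g where "g k = ((1 / of_nat d) gchoose k) * fps_nth (H ^ k) n" for k
  have n: "n > 0" "p ^ j \<le> n" using m p_gt_1 by (auto simp: n_def)
  have F_eq: "fps_nth F n = (\<Sum>k\<in>{1..n}. g k)"
    unfolding g_def fps_root_nth[OF F(1,2) d(2) F(3)]
    using n by (subst sum.atLeast_Suc_atMost) auto
  have E: "absv (of_nat d) * eps > 0" using d eps_pos by simp
  have dom: "gauss_dominant ((absv (of_nat d) * eps) ^ k) t (k * m) (H ^ k)" for k
    by (rule gauss_dominant_power[OF E t H])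
  have "absv (\<Sum>k\<in>{1..n}. g k) = eps * t ^ n"
  proof (rule sum_dominant[where j = "p ^ j"])
    show "p ^ j \<in> {1..n}" using n p_gt_1 by simp
    show "absv (g (p ^ j)) = eps * t ^ n"
    proof -
      have "absv (g (p ^ j)) = (eps ^ (p ^ j) / absv (fact (p ^ j))) * t ^ n"
        unfolding g_def mult using dom[of "p ^ j"] d
        by (simp add: gauss_dominant_def n_def abs_gbinomial_inverse power_mult_distrib)
      thus ?thesis by (simp only: eps_power_div_fact_eq)
    qed
    fix k assume k: "k \<in> {1..n}" "k \<noteq> p ^ j"
    let ?b = "absv ((1 / of_nat d) gchoose k)"
    have b: "?b > 0" using d by (simp add: abs_gbinomial_inverse)
    have "k * m \<noteq> n" using k m by (simp add: n_def)
    hence "absv (fps_nth (H ^ k) n) < (absv (of_nat d) * eps) ^ k * t ^ n"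
      using dom[of k] by (auto simp: gauss_dominant_def)
    hence "absv (g k) < ?b * ((absv (of_nat d) * eps) ^ k * t ^ n)"
      unfolding g_def mult using b by (intro mult_strict_left_mono)
    also have "\<dots> = (?b * (absv (of_nat d) * eps) ^ k) * t ^ n" by simp
    also have "\<dots> \<le> eps * t ^ n"
      using k t by (intro mult_right_mono abs_gbinomial_inverse_le d) auto
    finally show "absv (g k) < eps * t ^ n" .
  qed (use eps_pos t in auto)
  thus ?thesis using F_eq by (simp add: n_def)
qed

end

subsection \<open>The coefficients of \<open>\<phi>\<^sub>c\<close>\<close>

context padic_abs
begin

lemma powr_p_power: "(real p powr x) ^ m = real p powr (real m * x)"
  using p_gt_1 by (subst powr_power) (auto simp: mult.commute)

lemma powr_p_le_1: "x \<le> 0 \<Longrightarrow> real p powr x \<le> 1"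
  using p_gt_1 powr_mono[of x 0 "real p"] by simp

end

section \<open>The series \<open>H\<close> and its Newton polygon\<close>

locale boettcher = padic_abs absv p for absv :: "'a::field_char_0 \<Rightarrow> real" and p +
  fixes d :: nat and c :: 'a and a :: "nat \<Rightarrow> 'a"
  assumes d_ge_2: "d \<ge> 2" and p_dvd_d: "p dvd d" and c_nonzero: "c \<noteq> 0"
    and bottcher: "bottcher_coeffs d c a"
begin

definition H :: "'a fps" where "H = lac_fps d a + fps_const c * fps_X - 1"

definition E :: real where "E = absv (of_nat d) * eps"

definition v :: real where "v = - log p (absv (of_nat d))"

definition A :: real where "A = log p (absv c / E)"

lemma d_pos: "d > 0" and d_gt_1: "d > 1"
  using d_ge_2 by auto

lemma d_power_pos: "d ^ n > 0"
  using d_pos by simp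

lemma abs_d: "absv (of_nat d) = real p powr (- v)"
  using p_gt_1 d_pos by (simp add: v_def)

lemma v_pos: "v > 0"
  using abs_dvd_less_1[OF p_dvd_d d_pos] p_gt_1 d_pos by (simp add: v_def)

lemma E_pos: "E > 0"
  using eps_pos d_pos by (simp add: E_def)

lemma abs_c: "absv c = E * real p powr A"
  using p_gt_1 c_nonzero E_pos by (simp add: A_def)

lemma H_0: "fps_nth H 0 = 0" and H_1: "fps_nth H 1 = c"
  using d_gt_1 by (simp_all add: H_def lac_fps_def)

lemma H_mult_d: "n > 0 \<Longrightarrow> fps_nth H (n * d) = a n"
  using d_gt_1 mult_le_mono[of 1 n 2 d] by (auto simp: H_def lac_fps_def)

lemma H_cases:
  obtains "m = 0" | "m = 1" | n where "n > 0" "m = n * d" | "fps_nth H m = 0"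
  using d_pos by (cases "m = 0"; cases "m = 1"; cases "d dvd m")
    (auto simp: H_def lac_fps_def mult.commute elim!: dvdE)

lemma root_eq: "lac_fps 1 a ^ d = 1 + H" "fps_nth (lac_fps 1 a) 0 = 1"
  using bottcher by (auto simp: bottcher_coeffs_def H_def lac_fps_def)

lemma root_nth: "n > 0 \<Longrightarrow> fps_nth (lac_fps 1 a) n = a n"
  by (simp add: lac_fps_def)

text \<open>This drives all inductions: \<open>a n\<close> is controlled by \<open>H\<close> up to
  degree \<open>n\<close>, and it reappears as the coefficient of \<open>H\<close> in the larger
  degree \<open>n * d\<close>.\<close>

lemma a_le:
  assumes C: "0 \<le> C" "C \<le> 1" "0 \<le> t" and n: "n > 0"
    and H: "\<And>i. 0 < i \<Longrightarrow> i \<le> n \<Longrightarrow> absv (fps_nth H i) \<le> E * C * t ^ i"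
  shows "absv (a n) \<le> eps * C * t ^ n"
    and "absv (a n - fps_nth H n / of_nat d) \<le> eps * C\<^sup>2 * t ^ n"
proof -
  have H': "absv (fps_nth H i) \<le> absv (of_nat d) * eps * C * t ^ i" if "i \<le> n" for i
  proof (cases "i = 0")
    case True
    thus ?thesis using C E_pos unfolding E_def[symmetric] by (simp add: H_0)
  qed (use H that in \<open>simp flip: E_def\<close>)
  show "absv (a n) \<le> eps * C * t ^ n"
    and "absv (a n - fps_nth H n / of_nat d) \<le> eps * C\<^sup>2 * t ^ n"
    using abs_root_nth_le[OF root_eq H_0 p_dvd_d d_pos C n H'] root_nth[OF n] by simp_all
qed

text \<open>Taking the root costs a factor \<open>1 / absv (of_nat d)\<close>. Passing from degree
  \<open>n\<close> to \<open>n * d\<close> gains \<open>(t ^ (d - 1)) ^ n\<close>, which repays it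
  by the hypothesis on \<open>t\<close>.\<close>

lemma H_le_base:
  assumes C: "0 \<le> C" "C \<le> 1" "0 < t" and c: "absv c \<le> E * C * t"
    and t: "absv (of_nat d) * t ^ (d - 1) \<ge> 1" and m: "m > 0"
  shows "absv (fps_nth H m) \<le> E * C * t ^ m"
  using m
proof (induction m rule: less_induct)
  case (less m)
  show ?case
  proof (cases m rule: H_cases)
    case (3 n)
    have n: "n < m" using 3 d_gt_1 by simp
    have "absv (fps_nth H m) = absv (a n)" using 3 H_mult_d by simp
    also have "\<dots> \<le> eps * C * t ^ n"
      by (rule a_le) (use C n less.IH in auto, use 3 in auto)
    also have "\<dots> = eps * C * t ^ n * 1" by simp
    also have "1 \<le> absv (of_nat d) * (t ^ (d - 1)) ^ n"
    proof -
      have D: "0 < absv (of_nat d)" "absv (of_nat d) < 1"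
        using d_pos abs_dvd_less_1[OF p_dvd_d d_pos] by simp_all
      \<comment> \<open>As \<open>absv (of_nat d) < 1\<close>, the hypothesis on \<open>t\<close>
        forces this, so raising to the power \<open>n \<ge> 1\<close> only helps.\<close>
      have "1 \<le> t ^ (d - 1)"
        using t D C by (smt (verit) mult_left_le_one_le zero_less_power)
      hence "t ^ (d - 1) \<le> (t ^ (d - 1)) ^ n" using 3 by (simp add: self_le_power)
      thus ?thesis using t D by (smt (verit) mult_left_mono)
    qed
    also have "eps * C * t ^ n * (absv (of_nat d) * (t ^ (d - 1)) ^ n) = E * C * t ^ (n + (d - 1) * n)"
      by (simp add: E_def power_add power_mult)
    also have "n + (d - 1) * n = m" using 3 d_pos by (cases d) auto
    finally show ?thesis using C eps_pos by (simp add: mult_left_mono)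
  qed (use c less.prems C E_pos H_1 in auto)
qed

text \<open>Substituting \<open>x\<^sup>d\<close> divides the slope of a bound by \<open>d\<close>, and extracting the root costs a
  factor \<open>\<bar>d\<bar>\<^sup>-\<^sup>1\<close>.\<close>

lemma H_le_step:
  assumes C: "0 \<le> C" "C \<le> 1" "0 < s"
    and H: "\<And>m. m > 0 \<Longrightarrow> absv (fps_nth H m) \<le> E * C * (s ^ d) ^ m"
    and c: "absv c \<le> E * (C / absv (of_nat d)) * s" and m: "m > 0"
  shows "absv (fps_nth H m) \<le> E * (C / absv (of_nat d)) * s ^ m"
proof (cases m rule: H_cases)
  case (3 n)
  have "absv (fps_nth H m) = absv (a n)" using 3 H_mult_d by simp
  also have "\<dots> \<le> eps * C * (s ^ d) ^ n" by (rule a_le) (use C 3 H in auto)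
  also have "\<dots> = E * (C / absv (of_nat d)) * s ^ m"
    using 3 d_pos by (simp add: E_def mult.commute flip: power_mult)
  finally show ?thesis .
qed (use c m C E_pos H_1 in auto)

text \<open>On a logarithmic scale the expected size of \<open>H\<^sub>m\<close> at \<open>m = d\<^sup>j\<close> is \<open>A + j v\<close>.  The lines
  through two consecutive points of this kind bound all coefficients.\<close>

definition slope :: "nat \<Rightarrow> real" where "slope j = v / (real d - 1) / real d ^ j"

definition intercept :: "nat \<Rightarrow> real" where "intercept j = A - v / (real d - 1) + real j * v"

lemma intercept_mono: "i \<le> j \<Longrightarrow> intercept i \<le> intercept j"
  using v_pos by (simp add: intercept_def mult_right_mono)

lemma H_le_line:
  assumes "\<And>i. i < N \<Longrightarrow> intercept i \<le> 0" "N > 0" "j \<le> N" "m > 0"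
  shows "absv (fps_nth H m) \<le> E * real p powr intercept j * (real p powr slope j) ^ m"
  using assms(3,4)
proof (induction j arbitrary: m)
  case 0
  have "absv c = E * real p powr intercept 0 * real p powr slope 0"
    by (simp add: abs_c intercept_def slope_def flip: powr_add)
  moreover have "absv (of_nat d) * (real p powr slope 0) ^ (d - 1) = 1"
    using d_gt_1 p_gt_1 unfolding powr_p_power abs_d
    by (simp add: slope_def of_nat_diff flip: powr_add)
  moreover have "real p powr intercept 0 \<le> 1"
    using assms(1)[of 0] assms(2) by (simp add: powr_p_le_1)
  ultimately show ?case using 0 p_gt_1 by (intro H_le_base) auto
next
  case (Suc j)
  have C: "real p powr intercept j \<le> 1"
    using assms(1)[of j] Suc.prems p_gt_1 by (simp add: powr_p_le_1)
  have s: "(real p powr slope (Suc j)) ^ d = real p powr slope j"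
    unfolding powr_p_power using d_pos by (simp add: slope_def)
  have C': "real p powr intercept j / absv (of_nat d) = real p powr intercept (Suc j)"
    unfolding abs_d by (simp add: intercept_def algebra_simps flip: powr_diff)
  \<comment> \<open>The linear term \<open>c x\<close> does not come from the substitution, so the
    point \<open>(1, A)\<close> is checked against the new line; \<open>v / (d - 1) \<le> v\<close>
    decides.\<close>
  have "A \<le> intercept (Suc j) + slope (Suc j)"
  proof -
    have "v / (real d - 1) \<le> v / 1" using v_pos d_ge_2 by (intro divide_left_mono) auto
    moreover have "slope (Suc j) \<ge> 0" using v_pos d_gt_1 by (simp add: slope_def)
    moreover have "real j * v \<ge> 0" using v_pos by simp
    ultimately show ?thesis by (simp add: intercept_def algebra_simps)
  qed
  hence "absv c \<le> E * real p powr (intercept (Suc j) + slope (Suc j))"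
    unfolding abs_c using E_pos p_gt_1 by (intro mult_left_mono powr_mono) auto
  hence c: "absv c \<le> E * real p powr intercept (Suc j) * real p powr slope (Suc j)"
    by (simp add: powr_add)
  show ?case
    unfolding C'[symmetric]
    by (rule H_le_step) (use C c Suc p_gt_1 in \<open>auto simp: s C'\<close>)
qed

text \<open>The linear term \<open>H / d\<close> of the root carries the vertex at
  \<open>d ^ j\<close> to the next one. The remainder is strictly smaller: its bound has exponent
  \<open>intercept j + (A + j v)\<close>, and \<open>intercept j\<close> is negative.\<close>

lemma H_d_power:
  assumes "\<And>i. i < N \<Longrightarrow> intercept i < 0" "j \<le> N"
  shows "absv (fps_nth H (d ^ j)) = E * real p powr (A + real j * v)"
  using assms(2)
proof (induction j)
  case 0
  show ?case using H_1 abs_c by simp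
next
  case (Suc j)
  define x where "x = fps_nth H (d ^ j) / of_nat d"
  have le: "absv (fps_nth H m) \<le> E * real p powr intercept j * (real p powr slope j) ^ m"
    if "m > 0" for m
    by (rule H_le_line[where N = N]) (use assms Suc.prems that in \<open>auto simp: less_imp_le\<close>)
  have x: "absv x = eps * real p powr (A + real j * v)"
    using Suc d_pos by (simp add: x_def divide E_def)
  have "absv (a (d ^ j) - x)
      \<le> eps * (real p powr intercept j)\<^sup>2 * (real p powr slope j) ^ (d ^ j)"
    unfolding x_def
    by (rule a_le) (use le assms(1)[of j] Suc.prems p_gt_1 d_pos
        in \<open>auto simp: powr_p_le_1 less_imp_le\<close>)
  also have "\<dots> = eps * real p powr (2 * intercept j + v / (real d - 1))"
    unfolding powr_p_power using d_pos by (simp add: slope_def powr_add)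
  also have "\<dots> < eps * real p powr (A + real j * v)"
    using assms(1)[of j] Suc.prems eps_pos p_gt_1
    by (intro mult_strict_left_mono powr_less_mono) (auto simp: intercept_def)
  finally have "absv (a (d ^ j)) = absv x"
    using add_dominant[of "a (d ^ j) - x" x] x by simp
  moreover have "eps * real p powr (A + real j * v) = E * real p powr (A + real (Suc j) * v)"
    using p_gt_1 unfolding E_def abs_d
    by (simp add: algebra_simps flip: powr_add)
  ultimately show ?case
    using H_mult_d[OF d_power_pos, of j] x by (simp add: mult.commute)
qed

text \<open>On the logarithmic scale this is the slope of the line from the origin to
  \<open>(d ^ N, A + N v)\<close>. It is the \<open>r\<close> of the theorem, by
  \<open>rate_eq\<close>.\<close>

definition rate :: "nat \<Rightarrow> real" where "rate N = real p powr ((A + real N * v) / real d ^ N)"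

text \<open>For \<open>N > 0\<close>, lines \<open>N - 1\<close> and \<open>N\<close> both meet the
  line through the origin of slope \<open>\<tau>\<close> at \<open>d ^ N\<close>. The first has
  negative intercept, so it lies below on the left; the second has positive intercept, so it lies
  below on the right.\<close>

lemma gauss_dominant_H:
  assumes lower: "intercept N > 0" and upper: "N > 0 \<Longrightarrow> intercept (N - 1) < 0"
  shows "gauss_dominant E (rate N) (d ^ N) H"
proof (cases "N = 0")
  case True
  define t where "t = real p powr A"
  \<comment> \<open>A positive \<open>intercept 0\<close> is the strict form of the hypothesis of
    \<open>H_le_base\<close>; it yields strict bounds in the degrees \<open>n * d\<close>.\<close>
  have t: "absv (of_nat d) * t ^ (d - 1) > 1"
  proof -
    have "v < (real d - 1) * A"
      using lower True d_gt_1 by (simp add: intercept_def divide_less_eq mult.commute)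
    thus ?thesis unfolding t_def powr_p_power abs_d using p_gt_1 d_gt_1
      by (simp add: of_nat_diff flip: powr_add)
  qed
  have "v / (real d - 1) > 0" using v_pos d_gt_1 by simp
  hence A_pos: "A > 0" using lower True by (simp add: intercept_def)
  have le: "absv (fps_nth H m) \<le> E * 1 * t ^ m" if "m > 0" for m
    by (rule H_le_base) (use that t p_gt_1 in \<open>auto simp: t_def abs_c\<close>)
  have "absv (fps_nth H m) < E * t ^ m" if "m \<noteq> 1" for m
  proof (cases m rule: H_cases)
    case (3 n)
    have "t > 1" using A_pos p_gt_1 by (simp add: t_def)
    have "absv (fps_nth H m) = absv (a n)" using 3 H_mult_d by simp
    also have "\<dots> \<le> eps * 1 * t ^ n" by (rule a_le) (use 3 le p_gt_1 in \<open>auto simp: t_def\<close>)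
    also have "\<dots> < eps * t ^ n * (absv (of_nat d) * t ^ (d - 1))"
      using t eps_pos \<open>t > 1\<close> by simp
    also have "\<dots> = E * t ^ (n + (d - 1))" by (simp add: E_def power_add)
    also have "\<dots> \<le> E * t ^ m"
    proof (intro mult_left_mono power_increasing)
      show "n + (d - 1) \<le> m" unfolding 3 using 3(1) d_pos by (cases n; cases d) auto
    qed (use \<open>t > 1\<close> E_pos in auto)
    finally show ?thesis .
  qed (use that E_pos p_gt_1 in \<open>auto simp: t_def H_0\<close>)
  thus ?thesis using True by (simp add: gauss_dominant_def rate_def H_1[simplified] abs_c flip: t_def)
next
  case False
  define \<tau> where "\<tau> = (A + real N * v) / real d ^ N"
  have \<tau>: "\<tau> * real d ^ N = A + real N * v" using d_pos by (simp add: \<tau>_def)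
  have neg: "intercept i < 0" if "i < N" for i
    using upper False intercept_mono[of i "N - 1"] that by (simp add: less_eq_Suc_le) linarith
  have line: "absv (fps_nth H m) \<le> E * real p powr (intercept j + real m * slope j)"
    if "j \<le> N" "m > 0" for j m
    using H_le_line[of N j m] neg that False
    by (simp add: less_imp_le powr_p_power powr_add)
  have at1: "intercept (N - 1) + real d ^ N * slope (N - 1) = \<tau> * real d ^ N"
  proof -
    obtain M where M: "N = Suc M" using False by (cases N) auto
    have "real d * (v / (real d - 1)) = v + v / (real d - 1)"
      using d_gt_1 by (simp add: field_simps)
    moreover have "real d ^ Suc M * slope M = real d * (v / (real d - 1))"
      using d_pos by (simp add: slope_def)
    ultimately have "intercept M + real d ^ Suc M * slope M = A + real (Suc M) * v"
      by (simp add: intercept_def algebra_simps)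
    thus ?thesis unfolding \<tau> by (simp add: M)
  qed
  have at2: "intercept N + real d ^ N * slope N = \<tau> * real d ^ N"
    unfolding \<tau> using d_pos by (simp add: intercept_def slope_def)
  have dN: "real d ^ N > 0" using d_pos by simp
  have "absv (fps_nth H m) < E * rate N ^ m" if "m \<noteq> d ^ N" for m
  proof (cases "m = 0")
    case True
    thus ?thesis using E_pos H_0 by simp
  next
    case m0: False
    have "\<exists>j\<le>N. intercept j + real m * slope j < real m * \<tau>"
    proof (cases "m < d ^ N")
      case True
      hence "real m < real d ^ N" by (metis of_nat_less_iff of_nat_power)
      moreover have "(slope (N - 1) - \<tau>) * real d ^ N > 0"
        using at1 upper False by (simp add: algebra_simps)
      hence "slope (N - 1) - \<tau> > 0" using dN by (simp add: zero_less_mult_iff)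
      ultimately have "real m * (slope (N - 1) - \<tau>) < real d ^ N * (slope (N - 1) - \<tau>)"
        by (rule mult_strict_right_mono)
      hence "intercept (N - 1) + real m * slope (N - 1) < real m * \<tau>"
        using at1 by (simp add: algebra_simps)
      thus ?thesis by (intro exI[of _ "N - 1"]) simp
    next
      case False
      hence "m > d ^ N" using that by simp
      hence "real m > real d ^ N" by (metis of_nat_less_iff of_nat_power)
      moreover have "(\<tau> - slope N) * real d ^ N > 0"
        using at2 lower by (simp add: algebra_simps)
      hence "\<tau> - slope N > 0" using dN by (simp add: zero_less_mult_iff)
      ultimately have "real d ^ N * (\<tau> - slope N) < real m * (\<tau> - slope N)"
        by (rule mult_strict_right_mono)
      hence "intercept N + real m * slope N < real m * \<tau>"
        using at2 by (simp add: algebra_simps)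
      thus ?thesis by blast
    qed
    then obtain j where j: "j \<le> N" "intercept j + real m * slope j < real m * \<tau>" by blast
    have "absv (fps_nth H m) \<le> E * real p powr (intercept j + real m * slope j)"
      by (rule line) (use j m0 in auto)
    also have "\<dots> < E * real p powr (real m * \<tau>)"
      using j E_pos p_gt_1 by (intro mult_strict_left_mono powr_less_mono) auto
    finally show ?thesis by (simp add: rate_def powr_p_power flip: \<tau>_def)
  qed
  moreover have "absv (fps_nth H (d ^ N)) = E * rate N ^ (d ^ N)"
    using H_d_power[OF neg order.refl] \<tau>
    by (simp add: rate_def powr_p_power mult.commute flip: \<tau>_def)
  ultimately show ?thesis by (simp add: gauss_dominant_def)
qed

lemma a_bounds:
  assumes "intercept N > 0" "N > 0 \<Longrightarrow> intercept (N - 1) < 0"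
  shows "n > 0 \<Longrightarrow> absv (a n) \<le> eps * rate N ^ n"
    and "absv (a (p ^ j * d ^ N)) = eps * rate N ^ (p ^ j * d ^ N)"
proof -
  have dom: "gauss_dominant E (rate N) (d ^ N) H" by (rule gauss_dominant_H[OF assms])
  have pos: "rate N > 0" using p_gt_1 by (simp add: rate_def)
  have "absv (fps_nth H i) \<le> E * 1 * rate N ^ i" for i
    using dom unfolding gauss_dominant_def by (cases "i = d ^ N") (auto simp: less_imp_le)
  thus "n > 0 \<Longrightarrow> absv (a n) \<le> eps * rate N ^ n"
    using a_le(1)[of 1 "rate N" n] pos by simp
  have "p ^ j * d ^ N > 0" using d_pos p_gt_1 by simp
  from root_nth[OF this] show "absv (a (p ^ j * d ^ N)) = eps * rate N ^ (p ^ j * d ^ N)"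
    using abs_root_nth_eq[OF root_eq H_0 p_dvd_d d_pos pos d_power_pos, of N j]
      dom[unfolded E_def]
    by (simp only:)
qed

end

subsection \<open>The compositional inverse\<close>

text \<open>In the coordinate \<open>u = 1/z\<close> the two maps are \<open>h\<close> and
  \<open>k\<close>, and the hypothesis says \<open>k \<circ> h = X\<close>. Then
  \<open>(h \<circ> k - X) \<circ> h = 0\<close>, and composition with the nonzero \<open>h\<close>
  on the right is injective.\<close>

lemma inverse_coeffs_commute:
  assumes "inverse_coeffs d a a'"
  shows "inverse_coeffs d a' a"
proof -
  define P where "P = lac_fps d a"
  define Q where "Q = lac_fps d a'"
  define h where "h = fps_X * inverse P"
  define k where "k = fps_X * inverse Q"
  have P0: "fps_nth P 0 = 1" and Q0: "fps_nth Q 0 = 1" by (simp_all add: P_def Q_def lac_fps_def)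
  have h0: "fps_nth h 0 = 0" and k0: "fps_nth k 0 = 0" by (simp_all add: h_def k_def)
  have "P * fps_compose Q h = 1"
    using assms by (simp add: inverse_coeffs_def P_def Q_def h_def)
  hence "inverse (fps_compose Q h) = P"
    by (metis fps_inverse_unique mult.commute)
  hence "fps_compose k h = fps_X * (inverse P * P)"
    using h0 Q0 by (simp add: k_def fps_compose_mult_distrib fps_inverse_compose) (simp add: h_def)
  hence kh: "fps_compose k h = fps_X" using P0 by (simp add: inverse_mult_eq_1)
  have "fps_compose (fps_compose h k - fps_X) h = 0"
    using kh h0 k0 by (simp add: fps_compose_sub_distrib flip: fps_compose_assoc)
  moreover have "h \<noteq> 0" using P0 by (simp add: h_def)
  ultimately have "fps_compose h k = fps_X" using h0 by (simp add: fps_compose_eq_0_iff)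
  hence "fps_X * (inverse Q * inverse (fps_compose P k)) = fps_X * 1"
    using k0 P0 by (simp add: h_def fps_compose_mult_distrib fps_inverse_compose)
      (simp add: k_def mult.assoc)
  hence "inverse (Q * fps_compose P k) = 1"
    unfolding fps_inverse_mult mult_left_cancel[OF fps_X_neq_zero] by simp
  moreover have "fps_nth (Q * fps_compose P k) 0 = 1" using P0 Q0 by simp
  ultimately have "Q * fps_compose P k = 1"
    by (metis fps_inverse_one fps_inverse_idempotent zero_neq_one)
  thus ?thesis by (simp add: inverse_coeffs_def P_def Q_def k_def)
qed

context nonarch_abs
begin

text \<open>The relation reads \<open>Q(X / P) = 1 / P\<close>. Its coefficient of degree
  \<open>m\<close> contains that of \<open>Q\<close> with factor 1; the others involve lower
  coefficients of \<open>Q\<close> and powers of \<open>1 / P\<close>, so induction applies.\<close>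

lemma inverse_coeffs_bound:
  assumes inv: "inverse_coeffs d a a'" and d: "d > 0" and C: "0 \<le> C" "C \<le> 1" "0 \<le> t"
    and a: "\<And>n. n > 0 \<Longrightarrow> absv (a n) \<le> C * t ^ n" and n: "n > 0"
  shows "absv (a' n) \<le> C * t ^ n"
proof -
  define P where "P = lac_fps d a"
  define Q where "Q = lac_fps d a'"
  \<comment> \<open>\<open>lac_fps d\<close> puts \<open>a n\<close> in degree \<open>n * d\<close>,
    so a rate \<open>t\<close> per index is a rate \<open>s\<close> per degree.\<close>
  define s where "s = root d t"
  have s: "0 \<le> s" "s ^ d = t" using d C by (simp_all add: s_def)
  have P0: "fps_nth P 0 = 1" and Q0: "fps_nth Q 0 = 1" by (simp_all add: P_def Q_def lac_fps_def)
  have P: "absv (fps_nth P m) \<le> C * s ^ m" if "m > 0" for m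
  proof (cases "d dvd m")
    case True
    then obtain i where i: "m = d * i" by blast
    thus ?thesis using that a[of i] d s by (simp add: P_def lac_fps_def power_mult)
  qed (use that C s in \<open>simp add: P_def lac_fps_def\<close>)
  have invP: "absv (fps_nth (inverse P) m) \<le> C * s ^ m" if "m > 0" for m
    using fps_one_plus_inverse_bound[OF C(1,2) s(1) P0 P that order.refl] .
  have invP0: "fps_nth (inverse P) 0 = 1" using P0 by simp
  have powP: "absv (fps_nth (inverse P ^ k) m) \<le> C * s ^ m" if "m > 0" for m k
    using fps_one_plus_power_bound[OF C(1,2) s(1) invP0 invP that order.refl] .
  have "P * fps_compose Q (fps_X * inverse P) = 1"
    using inv by (simp add: inverse_coeffs_def P_def Q_def)
  hence comp: "fps_compose Q (fps_X * inverse P) = inverse P"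
    by (metis fps_inverse_unique)
  have Q: "absv (fps_nth Q m) \<le> C * s ^ m" if "m > 0" for m
    using that
  proof (induction m rule: less_induct)
    case (less m)
    have "fps_nth (inverse P) m = (\<Sum>j\<in>{0..m}. fps_nth Q j * fps_nth (inverse P ^ j) (m - j))"
      by (subst comp[symmetric], unfold fps_compose_nth, intro sum.cong)
        (auto simp: power_mult_distrib fps_X_power_mult_nth)
    also have "{0..m} = insert m {..<m}" by auto
    finally have "fps_nth Q m
        = fps_nth (inverse P) m - (\<Sum>j<m. fps_nth Q j * fps_nth (inverse P ^ j) (m - j))"
      using invP0 by (simp add: fps_power_zeroth)
    also have "absv \<dots> \<le> max (absv (fps_nth (inverse P) m))
        (absv (\<Sum>j<m. fps_nth Q j * fps_nth (inverse P ^ j) (m - j)))"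
      by (rule ultra_diff)
    also have "\<dots> \<le> C * s ^ m"
    proof (intro max.boundedI invP less.prems sum_le)
      fix j assume "j \<in> {..<m}"
      hence j: "j < m" by simp
      show "absv (fps_nth Q j * fps_nth (inverse P ^ j) (m - j)) \<le> C * s ^ m"
      proof (cases "j = 0")
        case False
        have "C * s ^ j \<le> 1 * s ^ j" using C s by (intro mult_right_mono) auto
        hence "absv (fps_nth Q j) \<le> s ^ j" using less.IH[OF j] False by simp
        hence "absv (fps_nth Q j * fps_nth (inverse P ^ j) (m - j)) \<le> s ^ j * (C * s ^ (m - j))"
          unfolding mult using s j by (intro mult_mono powP) auto
        also have "\<dots> = C * s ^ m" using j by (simp flip: power_add)
        finally show ?thesis .
      qed (use j C s in auto)
    qed (use C s in auto)
    finally show ?case .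
  qed
  have "fps_nth Q (n * d) = a' n" using n d by (simp add: Q_def lac_fps_def)
  thus ?thesis using Q[of "n * d"] n d s by (simp add: mult.commute[of n] power_mult)
qed

subsection \<open>Radii of convergence\<close>

lemma radius_pow_le:
  assumes "r > 0" "\<And>n. n > 0 \<Longrightarrow> absv (g n) \<le> r ^ n"
  shows "radius_pow absv g \<le> ereal r"
  unfolding radius_pow_def
proof (rule Limsup_bounded)
  have "absv (g n) powr (1 / real n) \<le> r" if "n > 0" for n
  proof -
    have "absv (g n) powr (1 / real n) \<le> (r ^ n) powr (1 / real n)"
      using assms that by (intro powr_mono2) auto
    also have "\<dots> = r" using assms(1) that by (simp add: powr_powr flip: powr_realpow)
    finally show ?thesis .
  qed
  thus "\<forall>\<^sub>F n in sequentially. ereal (absv (g n) powr (1 / real n)) \<le> ereal r"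
    by (intro eventually_mono[OF eventually_gt_at_top[of 0]]) simp
qed

text \<open>The constant \<open>C < 1\<close> gives the finitely many coefficients not controlled by the limes
  superior the room to satisfy a bound of smaller rate.\<close>

lemma radius_pow_less:
  assumes less: "radius_pow absv g < ereal r" and r: "r > 0" and C: "0 < C" "C < 1"
    and g: "\<And>n. n > 0 \<Longrightarrow> absv (g n) \<le> C * r ^ n"
  obtains t where "0 < t" "t < r" "\<And>n. n > 0 \<Longrightarrow> absv (g n) \<le> t ^ n"
proof -
  obtain y where y: "radius_pow absv g < y" "y < ereal r" using less dense by blast
  from y(1) have "\<forall>\<^sub>F n in sequentially. ereal (absv (g n) powr (1 / real n)) < y"
    unfolding radius_pow_def by (rule Limsup_lessD)
  then obtain M0 where M0: "\<And>n. n \<ge> M0 \<Longrightarrow> ereal (absv (g n) powr (1 / real n)) < y"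
    by (auto simp: eventually_sequentially)
  have "0 \<le> ereal (absv (g M0) powr (1 / real M0))" by simp
  also have "\<dots> < y" by (rule M0) simp
  finally have "y > 0" .
  then obtain x where x: "y = ereal x" using y(2) by (cases y) auto
  define M where "M = Suc M0"
  \<comment> \<open>For \<open>n \<le> M\<close> the factor \<open>C\<close> is at most
    \<open>(C powr (1 / M)) ^ n\<close> and is absorbed into the rate; beyond \<open>M\<close> the
    rate \<open>x\<close> applies.\<close>
  define t where "t = max x (r * C powr (1 / real M))"
  have "C powr (1 / real M) < 1" using C powr_less_mono2[of "1 / real M" C 1] by (simp add: M_def)
  hence "t < r" using y x r by (simp add: t_def)
  moreover have t: "0 < t" using r C by (simp add: t_def less_max_iff_disj)
  moreover have "absv (g n) \<le> t ^ n" if n: "n > 0" for n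
  proof (cases "n \<le> M")
    case True
    have "C = C powr 1" using C by simp
    also have "\<dots> \<le> C powr (real n * (1 / real M))"
      using C True by (intro powr_mono') (auto simp: M_def)
    also have "\<dots> = (C powr (1 / real M)) ^ n"
      using C by (subst powr_power) (auto simp: mult.commute)
    finally have "C * r ^ n \<le> (r * C powr (1 / real M)) ^ n"
      using r by (simp add: power_mult_distrib mult.commute)
    also have "\<dots> \<le> t ^ n" using r C by (intro power_mono) (auto simp: t_def)
    finally show ?thesis using g[OF n] by linarith
  next
    case False
    have "absv (g n) = (absv (g n) powr (1 / real n)) ^ n"
      using n by (cases "g n = 0") (simp_all add: powr_power)
    also have "\<dots> \<le> t ^ n" using M0[of n] False x by (intro power_mono) (auto simp: M_def t_def)
    finally show ?thesis .
  qed
  ultimately show ?thesis using that by blast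
qed

end

subsection \<open>Isometries close to the identity\<close>

locale complete_nonarch_abs = nonarch_abs absv for absv :: "'a::field \<Rightarrow> real" +
  assumes complete: "\<And>X :: nat \<Rightarrow> 'a. (\<forall>e>0. \<exists>M. \<forall>m\<ge>M. \<forall>n\<ge>M. absv (X m - X n) < e)
    \<Longrightarrow> \<exists>L. (\<lambda>n. absv (X n - L)) \<longlonglongrightarrow> 0"
begin

text \<open>By the ultrametric inequality \<open>X n - X M\<close> is no larger than the largest
  consecutive difference between them, so the sequence is Cauchy.\<close>

lemma convergent_if_null_differences:
  assumes "(\<lambda>n. absv (X (Suc n) - X n)) \<longlonglongrightarrow> 0"
  shows "\<exists>L. (\<lambda>n. absv (X n - L)) \<longlonglongrightarrow> 0"
proof (rule complete, intro allI impI)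
  fix e :: real assume e: "e > 0"
  obtain M where M: "\<And>n. n \<ge> M \<Longrightarrow> absv (X (Suc n) - X n) < e"
    using LIMSEQ_D[OF assms e] by auto
  have to_M: "absv (X n - X M) < e" if "n \<ge> M" for n
    using that
  proof (induction n rule: dec_induct)
    case (step n)
    thus ?case using ultra[of "X (Suc n) - X n" "X n - X M"] M[of n] by auto
  qed (use e in simp)
  have "absv (X m - X n) < e" if "m \<ge> M" "n \<ge> M" for m n
    using ultra_diff[of "X m - X M" "X n - X M"] to_M[OF that(1)] to_M[OF that(2)] by simp
  thus "\<exists>M. \<forall>m\<ge>M. \<forall>n\<ge>M. absv (X m - X n) < e" by blast
qed

lemma abs_sums_if_null:
  assumes "(\<lambda>n. absv (f n)) \<longlonglongrightarrow> 0"
  shows "\<exists>s. abs_sums absv f s"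
  using convergent_if_null_differences[of "\<lambda>n. \<Sum>i<n. f i"] assms by (simp add: abs_sums_def)

text \<open>Injectivity and invariance of the spheres follow from the ultrametric inequality; a
  preimage of \<open>y\<close> is the limit of the iteration \<open>z \<mapsto> y - (f z - z)\<close>.\<close>

lemma bij_betw_near_identity:
  assumes C: "0 \<le> C" "C < 1" and \<rho>: "0 \<le> \<rho>"
    and diff: "\<And>z w. absv z > \<rho> \<Longrightarrow> absv w > \<rho> \<Longrightarrow> absv ((f z - z) - (f w - w)) \<le> C * absv (z - w)"
    and near: "\<And>z. absv z > \<rho> \<Longrightarrow> absv (f z - z) \<le> C * absv z"
  shows "bij_betw f (disk_inf absv \<rho>) (disk_inf absv \<rho>)"
    and "\<And>z w. absv z > \<rho> \<Longrightarrow> absv w > \<rho> \<Longrightarrow> absv (f z - f w) = absv (z - w)"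
proof -
  show iso: "absv (f z - f w) = absv (z - w)" if "absv z > \<rho>" "absv w > \<rho>" for z w
  proof (cases "z = w")
    case False
    have "C * absv (z - w) < 1 * absv (z - w)" using C False by (intro mult_strict_right_mono) auto
    hence "absv ((f z - z) - (f w - w)) < absv (z - w)" using diff[OF that] by simp
    from add_dominant[OF this] show ?thesis by (simp add: algebra_simps)
  qed simp
  have less: "C * x < x" if "x > \<rho>" for x
    using C \<rho> that mult_strict_right_mono[of C 1 x] by simp
  have sphere: "absv (f z) = absv z" if "absv z > \<rho>" for z
    using add_dominant[of "f z - z" z] near[OF that] less[OF that] by simp
  show "bij_betw f (disk_inf absv \<rho>) (disk_inf absv \<rho>)"
    unfolding bij_betw_def
  proof
    show "inj_on f (disk_inf absv \<rho>)"
    proof (rule inj_onI)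
      fix z w assume zw: "z \<in> disk_inf absv \<rho>" "w \<in> disk_inf absv \<rho>" "f z = f w"
      hence "absv (z - w) = 0" using iso[of z w] by (simp add: disk_inf_def)
      thus "z = w" by simp
    qed
    have "\<exists>z. absv z > \<rho> \<and> f z = y" if y: "absv y > \<rho>" for y
    proof -
      define X where "X n = ((\<lambda>z. y - (f z - z)) ^^ n) y" for n
      have X_Suc: "X (Suc n) = y - (f (X n) - X n)" for n by (simp add: X_def)
      have X_abs: "absv (X n) = absv y" for n
      proof (induction n)
        case (Suc n)
        thus ?case
          using add_dominant[of "- (f (X n) - X n)" y] near[of "X n"] less[OF y] y
          unfolding X_Suc minus by (simp add: algebra_simps)
      qed (simp add: X_def)
      have step: "absv (X (Suc n) - X n) \<le> C ^ n * absv (X 1 - X 0)" for n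
      proof (induction n)
        case (Suc n)
        have "X (Suc (Suc n)) - X (Suc n) = - ((f (X (Suc n)) - X (Suc n)) - (f (X n) - X n))"
          unfolding X_Suc[of "Suc n"] X_Suc[of n] by (simp add: algebra_simps)
        hence "absv (X (Suc (Suc n)) - X (Suc n)) \<le> C * absv (X (Suc n) - X n)"
          using diff[of "X (Suc n)" "X n"] X_abs y minus by metis
        also have "\<dots> \<le> C * (C ^ n * absv (X 1 - X 0))" using Suc C by (intro mult_left_mono)
        finally show ?case by simp
      qed simp
      have "(\<lambda>n. C ^ n * absv (X 1 - X 0)) \<longlonglongrightarrow> 0 * absv (X 1 - X 0)"
        using C by (intro tendsto_intros LIMSEQ_realpow_zero)
      hence "(\<lambda>n. C ^ n * absv (X 1 - X 0)) \<longlonglongrightarrow> 0" by simp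
      hence null: "(\<lambda>n. absv (X (Suc n) - X n)) \<longlonglongrightarrow> 0"
        by (rule Lim_null_comparison[rotated]) (use step in simp)
      then obtain L where L: "(\<lambda>n. absv (X n - L)) \<longlonglongrightarrow> 0"
        using convergent_if_null_differences by blast
      have "\<forall>\<^sub>F n in sequentially. absv (X n - L) < absv y"
        by (rule order_tendstoD(2)[OF L]) (use y \<rho> in linarith)
      then obtain n where "absv (X n - L) < absv (X n)" unfolding X_abs
        by (auto simp: eventually_sequentially)
      \<comment> \<open>All iterates lie on the sphere of \<open>y\<close>, and a limit of points on
        a sphere of positive radius stays on it; hence \<open>L\<close> remains in the open
        disk.\<close>
      hence "absv L = absv y"
        using add_dominant[of "L - X n" "X n"] X_abs[of n] by (simp add: minus_commute[of L])
      hence L_disk: "absv L > \<rho>" using y by simp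
      have "absv (f L - y) \<le> max (absv (X n - L)) (absv (X (Suc n) - X n))" for n
      proof -
        have "f L - y = (f L - f (X n)) - (X (Suc n) - X n)"
          by (simp add: X_Suc)
        also have "absv \<dots> \<le> max (absv (f L - f (X n))) (absv (X (Suc n) - X n))"
          by (rule ultra_diff)
        also have "absv (f L - f (X n)) = absv (X n - L)"
          using iso[OF L_disk, of "X n"] X_abs y by (simp add: minus_commute[of L])
        finally show ?thesis .
      qed
      moreover have "(\<lambda>n. max (absv (X n - L)) (absv (X (Suc n) - X n))) \<longlonglongrightarrow> max 0 0"
        using L null by (rule tendsto_max)
      ultimately have "absv (f L - y) \<le> max 0 0"
        by (intro LIMSEQ_le_const) auto
      hence "f L = y" using nonneg[of "f L - y"] by (simp add: antisym)
      thus ?thesis using L_disk by blast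
    qed
    thus "f ` disk_inf absv \<rho> = disk_inf absv \<rho>"
      using sphere by (auto simp: disk_inf_def image_iff)
  qed
qed

end

section \<open>Estimates for convergent sums and inverse powers\<close>

context nonarch_abs
begin

lemma abs_sums_le:
  assumes "abs_sums absv f s" "0 \<le> B" "\<And>n. absv (f n) \<le> B"
  shows "absv s \<le> B"
proof (rule ccontr)
  assume "\<not> absv s \<le> B"
  hence "absv s > B" by simp
  moreover have "\<forall>\<^sub>F n in sequentially. absv ((\<Sum>i<n. f i) - s) < absv s"
    using assms(1,2) \<open>absv s > B\<close> unfolding abs_sums_def
    by (intro order_tendstoD(2)[where y = 0]) auto
  then obtain n where "absv ((\<Sum>i<n. f i) - s) < absv s" by (auto simp: eventually_sequentially)
  hence "absv (\<Sum>i<n. f i) = absv s"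
    using add_dominant[of "(\<Sum>i<n. f i) - s" s] by simp
  moreover have "absv (\<Sum>i<n. f i) \<le> B" using assms by (intro sum_le) auto
  ultimately show False by simp
qed

lemma abs_sums_mult:
  assumes "abs_sums absv f s"
  shows "abs_sums absv (\<lambda>n. x * f n) (x * s)"
proof -
  have "(\<lambda>n. absv x * absv ((\<Sum>i<n. f i) - s)) \<longlonglongrightarrow> absv x * 0"
    using assms unfolding abs_sums_def by (intro tendsto_intros)
  thus ?thesis by (simp add: abs_sums_def algebra_simps flip: mult sum_distrib_left)
qed

lemma abs_sums_diff:
  assumes "abs_sums absv f s" "abs_sums absv g t"
  shows "abs_sums absv (\<lambda>n. f n - g n) (s - t)"
  unfolding abs_sums_def
proof (rule tendsto_sandwich[OF _ _ tendsto_const])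
  show "(\<lambda>n. max (absv ((\<Sum>i<n. f i) - s)) (absv ((\<Sum>i<n. g i) - t))) \<longlonglongrightarrow> 0"
    using tendsto_max[of _ 0 _ _ 0] assms unfolding abs_sums_def by fastforce
  have "absv ((\<Sum>i<n. f i - g i) - (s - t))
      \<le> max (absv ((\<Sum>i<n. f i) - s)) (absv ((\<Sum>i<n. g i) - t))" for n
    using ultra_diff[of "(\<Sum>i<n. f i) - s" "(\<Sum>i<n. g i) - t"]
    by (simp add: sum_subtractf algebra_simps)
  thus "\<forall>\<^sub>F n in sequentially. absv ((\<Sum>i<n. f i - g i) - (s - t))
      \<le> max (absv ((\<Sum>i<n. f i) - s)) (absv ((\<Sum>i<n. g i) - t))" by simp
qed simp

lemma abs_power_diff_le:
  assumes "absv x \<le> B" "absv y \<le> B"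
  shows "absv (x ^ Suc q - y ^ Suc q) \<le> absv (x - y) * B ^ q"
proof -
  have B: "0 \<le> B" using assms(1) nonneg[of x] by linarith
  have "absv (\<Sum>i<Suc q. y ^ (Suc q - Suc i) * x ^ i) \<le> B ^ q"
  proof (rule sum_le)
    fix i assume i: "i \<in> {..<Suc q}"
    have "absv (y ^ (Suc q - Suc i) * x ^ i) \<le> B ^ (Suc q - Suc i) * B ^ i"
      unfolding mult power using assms B by (intro mult_mono power_mono) auto
    also have "\<dots> = B ^ q" using i by (simp flip: power_add)
    finally show "absv (y ^ (Suc q - Suc i) * x ^ i) \<le> B ^ q" .
  qed (use B in auto)
  thus ?thesis unfolding power_diff_sumr2 mult by (intro mult_left_mono) auto
qed

text \<open>The difference of the inverses contributes \<open>absv (z - w) / \<mu>\<^sup>2\<close>,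
  and the cofactor contributes \<open>q - 1\<close> further inverse factors of
  \<open>\<mu>\<close>.\<close>

lemma abs_inverse_power_diff_le:
  assumes \<mu>: "0 < \<mu>" "\<mu> \<le> absv z" "\<mu> \<le> absv w"
  shows "absv (inverse z ^ q - inverse w ^ q) \<le> absv (z - w) / \<mu> ^ Suc q"
proof (cases q)
  case (Suc q')
  have nz: "z \<noteq> 0" "w \<noteq> 0" using \<mu> by auto
  have "absv (inverse z ^ q - inverse w ^ q) \<le> absv (inverse z - inverse w) * (inverse \<mu>) ^ q'"
    unfolding Suc using \<mu> by (intro abs_power_diff_le) (auto simp: inverse le_imp_inverse_le)
  also have "absv (inverse z - inverse w) = absv (z - w) * (inverse (absv z) * inverse (absv w))"
    using nz by (simp add: inverse_diff_inverse mult inverse minus_commute[of w])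
  also have "\<dots> * inverse \<mu> ^ q' \<le> absv (z - w) * (inverse \<mu> * inverse \<mu>) * inverse \<mu> ^ q'"
    using \<mu> by (intro mult_right_mono mult_left_mono mult_mono) (auto simp: le_imp_inverse_le)
  also have "\<dots> = absv (z - w) / \<mu> ^ Suc q"
    using \<mu> by (simp add: Suc divide_inverse power_inverse)
  finally show ?thesis .
qed (use \<mu> in simp)

end

section \<open>The lacunary series as a map of the disk\<close>

context complete_nonarch_abs
begin

text \<open>Each term of \<open>f z - z\<close> is Lipschitz with constant at most \<open>C\<close>
  on the disk, and ultrametrically so is the sum. Since \<open>C < 1\<close>,
  \<open>bij_betw_near_identity\<close> applies.\<close>

lemma lacunary_series_isometry:
  assumes d: "d > 0" and C: "0 < C" "C < 1" and r: "r > 0"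
    and a: "\<And>n. n > 0 \<Longrightarrow> absv (a n) \<le> C * r ^ n"
  defines "B \<equiv> disk_inf absv (r powr (1 / real d))"
  shows "\<exists>f. (\<forall>z\<in>B. abs_sums absv (\<lambda>n. a (Suc n) * z powi (- int ((Suc n) * d))) (f z / z - 1))
           \<and> bij_betw f B B
           \<and> (\<forall>z\<in>B. \<forall>w\<in>B. absv (f z - f w) = absv (z - w))"
proof -
  define \<rho> where "\<rho> = r powr (1 / real d)"
  define T where "T z n = a (Suc n) * z powi (- int ((Suc n) * d))" for z n
  define S where "S z = (SOME s. abs_sums absv (T z) s)" for z
  define f where "f z = z * (1 + S z)" for z
  have \<rho>: "0 < \<rho>" "\<rho> ^ d = r" using r d by (simp_all add: \<rho>_def powr_power)
  have nz: "z \<noteq> 0" if "absv z > \<rho>" for z using that \<rho> by auto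
  have pow: "r < absv z ^ d" if "absv z > \<rho>" for z
    using power_strict_mono[OF that, of d] \<rho> d by simp
  have T: "T z n = a (Suc n) * inverse z ^ (Suc n * d)" for z n
    by (simp only: T_def power_int_minus power_int_of_nat power_inverse)
  have T_le: "absv (T z n) \<le> C * (r / absv z ^ d) ^ Suc n" if z: "absv z > \<rho>" for z n
  proof -
    have "absv (T z n) = absv (a (Suc n)) * inverse ((absv z ^ d) ^ Suc n)"
      unfolding T mult power inverse by (simp only: power_inverse mult.commute[of "Suc n"] power_mult)
    also have "\<dots> \<le> (C * r ^ Suc n) * inverse ((absv z ^ d) ^ Suc n)"
      by (intro mult_right_mono a) auto
    also have "\<dots> = C * (r / absv z ^ d) ^ Suc n" by (simp only: power_divide divide_inverse mult.assoc power_mult_distrib power_inverse)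
    finally show ?thesis .
  qed
  have sums: "abs_sums absv (T z) (S z)" if z: "absv z > \<rho>" for z
  proof -
    have "(\<lambda>n. C * (r / absv z ^ d) ^ Suc n) \<longlonglongrightarrow> C * 0"
      using r pow[OF z] by (intro tendsto_intros LIMSEQ_Suc LIMSEQ_realpow_zero) auto
    hence "(\<lambda>n. C * (r / absv z ^ d) ^ Suc n) \<longlonglongrightarrow> 0" by (simp only: mult_zero_right)
    hence "(\<lambda>n. absv (T z n)) \<longlonglongrightarrow> 0"
      by (rule Lim_null_comparison[rotated]) (simp del: power_Suc add: T_le[OF z])
    from abs_sums_if_null[OF this] show ?thesis unfolding S_def by (rule someI_ex)
  qed
  have near: "absv (f z - z) \<le> C * absv z" if z: "absv z > \<rho>" for z
  proof -
    have "absv (S z) \<le> C"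
    proof (rule abs_sums_le[OF sums[OF z]])
      fix n
      have "(r / absv z ^ d) ^ Suc n \<le> 1" using r pow[OF z] by (intro power_le_one) auto
      thus "absv (T z n) \<le> C" using T_le[OF z, of n] C
        by (smt (verit) mult_left_le)
    qed (use C in simp)
    hence "absv z * absv (S z) \<le> absv z * C" by (intro mult_left_mono) auto
    thus ?thesis by (simp add: f_def algebra_simps mult)
  qed
  have diff: "absv ((f z - z) - (f w - w)) \<le> C * absv (z - w)"
    if z: "absv z > \<rho>" and w: "absv w > \<rho>" for z w
  proof -
    define \<mu> where "\<mu> = min (absv z) (absv w)"
    have \<mu>: "0 < \<mu>" "\<mu> \<le> absv z" "\<mu> \<le> absv w" using nz[OF z] nz[OF w] by (simp_all add: \<mu>_def)
    have \<mu>_pow: "r < \<mu> ^ d" using pow[OF z] pow[OF w] by (simp add: \<mu>_def min_def)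
    have "abs_sums absv (\<lambda>n. z * T z n - w * T w n) (z * S z - w * S w)"
      by (intro abs_sums_diff abs_sums_mult sums z w)
    hence "absv (z * S z - w * S w) \<le> C * absv (z - w)"
    proof (rule abs_sums_le)
      fix n
      \<comment> \<open>In \<open>z * T z n\<close> the outer factor cancels one inverse, which
        leaves the exponent \<open>q = Suc n * d - 1\<close>.\<close>
      obtain q where q: "Suc n * d = Suc q" using d by (cases "Suc n * d") auto
      have "z * T z n - w * T w n = a (Suc n) * (inverse z ^ q - inverse w ^ q)"
        unfolding T q using nz[OF z] nz[OF w]
        by (simp add: field_simps)
      hence "absv (z * T z n - w * T w n) \<le> (C * r ^ Suc n) * (absv (z - w) / \<mu> ^ Suc q)"
        unfolding mult using C r
        by (simp only: mult) (intro mult_mono a abs_inverse_power_diff_le \<mu>, auto)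
      also have "\<mu> ^ Suc q = (\<mu> ^ d) ^ Suc n" by (simp only: q[symmetric] mult.commute[of "Suc n"] power_mult)
      also have "(C * r ^ Suc n) * (absv (z - w) / (\<mu> ^ d) ^ Suc n)
          = C * absv (z - w) * (r / \<mu> ^ d) ^ Suc n"
        by (simp only: power_divide times_divide_eq_right mult_ac)
      also have "\<dots> \<le> C * absv (z - w) * 1"
        using C r \<mu>_pow by (intro mult_left_mono power_le_one) auto
      finally show "absv (z * T z n - w * T w n) \<le> C * absv (z - w)" by simp
    qed (use C in simp)
    thus ?thesis by (simp add: f_def algebra_simps)
  qed
  have "abs_sums absv (T z) (f z / z - 1)" if "absv z > \<rho>" for z
    using sums[OF that] nz[OF that] by (simp add: f_def)
  moreover have "bij_betw f (disk_inf absv \<rho>) (disk_inf absv \<rho>)"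
    "\<And>z w. absv z > \<rho> \<Longrightarrow> absv w > \<rho> \<Longrightarrow> absv (f z - f w) = absv (z - w)"
    using bij_betw_near_identity[of C \<rho> f] C \<rho> diff near by auto
  ultimately show ?thesis unfolding B_def \<rho>_def[symmetric] T_def
    by (intro exI[of _ f]) (simp add: disk_inf_def)
qed

end

subsection \<open>The radius of \<open>\<phi>\<^sub>c\<close> and of its inverse\<close>

context boettcher
begin

text \<open>From \<open>d! = d * (d - 1)!\<close> the exponent is that of \<open>d!\<close> minus
  \<open>v\<close>, and Legendre's formula applies to \<open>d!\<close>. The inequality serves the
  upper bound on the valuation of \<open>c\<close>, the equality the lower one.\<close>

lemma fact_exponent_le:
  "real (multiplicity p (fact (d - 1))) / real (d - 1) \<le> 1 / (real p - 1) - v / (real d - 1)"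
  and fact_exponent_eq: "d = p ^ k \<Longrightarrow>
  real (multiplicity p (fact (d - 1))) / real (d - 1) = 1 / (real p - 1) - v / (real d - 1)"
proof -
  obtain d' where d': "d = Suc d'" "d' > 0" using d_gt_1 by (cases d) auto
  have v: "v = real (multiplicity p d)"
    unfolding v_def abs_of_nat[OF d_pos] using p_gt_1 by simp
  have "multiplicity p (fact d) = multiplicity p d + multiplicity p (fact d')"
    unfolding d' fact_Suc of_nat_id using prime_p
    by (intro prime_elem_multiplicity_mult_distrib) auto
  hence e: "real (multiplicity p (fact d')) = real (multiplicity p (fact d)) - v"
    using v by simp
  have "real (multiplicity p (fact d) * (p - 1)) \<le> real d'"
    using multiplicity_fact_le[OF prime_p d_pos] d' by (simp only: of_nat_le_iff diff_Suc_1)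
  hence "real (multiplicity p (fact d)) \<le> real d' / (real p - 1)"
    using p_gt_1 by (simp add: of_nat_diff pos_le_divide_eq)
  hence "real (multiplicity p (fact d')) / real d' \<le> (real d' / (real p - 1) - v) / real d'"
    unfolding e by (intro divide_right_mono) auto
  thus "real (multiplicity p (fact (d - 1))) / real (d - 1) \<le> 1 / (real p - 1) - v / (real d - 1)"
    using d' by (simp add: diff_divide_distrib)
  assume dk: "d = p ^ k"
  have "real (multiplicity p (fact d) * (p - 1)) = real d'"
    using multiplicity_fact_prime_power[OF prime_p, of k] d' by (simp only: dk[symmetric] diff_Suc_1)
  hence "real (multiplicity p (fact d)) = real d' / (real p - 1)"
    using p_gt_1 by (simp add: of_nat_diff eq_divide_eq)
  hence "real (multiplicity p (fact d')) / real d' = (real d' / (real p - 1) - v) / real d'"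
    unfolding e by simp
  thus "real (multiplicity p (fact (d - 1))) / real (d - 1) = 1 / (real p - 1) - v / (real d - 1)"
    using d' by (simp add: diff_divide_distrib)
qed

text \<open>In this form the signs of \<open>intercept N\<close> and
  \<open>intercept (N - 1)\<close> can be read off from the bounds on the valuation of
  \<open>c\<close>.\<close>

lemma intercept_eq:
  "intercept N = log p (absv c) + real (N + 1) * v + 1 / (real p - 1) - v / (real d - 1)"
proof -
  have "log p E = - v - 1 / (real p - 1)"
    unfolding E_def eps_def using p_gt_1 d_pos by (simp add: log_mult v_def)
  hence "A = log p (absv c) + v + 1 / (real p - 1)"
    unfolding A_def using p_gt_1 c_nonzero E_pos by (simp add: log_divide)
  thus ?thesis by (simp add: intercept_def algebra_simps)
qed

lemma rate_eq:
  "rate N = (absv (c / of_nat d ^ (N + 1)) * real p powr (1 / (real p - 1))) powr (1 / real d ^ N)"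
proof -
  have "absv (c / of_nat d ^ (N + 1)) * real p powr (1 / (real p - 1)) = real p powr (A + real N * v)"
    unfolding divide power abs_c E_def abs_d powr_p_power eps_def
    by (simp add: algebra_simps flip: powr_add powr_diff)
  thus ?thesis by (simp add: rate_def powr_powr)
qed

lemma rate_gt_1:
  assumes "intercept N > 0"
  shows "rate N > 1"
proof -
  have "v / (real d - 1) > 0" using v_pos d_gt_1 by simp
  hence "A + real N * v > 0" using assms by (simp add: intercept_def)
  thus ?thesis unfolding rate_def using p_gt_1 d_pos by simp
qed

lemma radius_pow_eq:
  assumes N: "intercept N > 0" "N > 0 \<Longrightarrow> intercept (N - 1) < 0"
    and inv: "inverse_coeffs d a a'"
  shows "radius_pow absv a = ereal (rate N)" and "radius_pow absv a' = ereal (rate N)"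
proof -
  have r: "rate N > 0" using rate_gt_1[OF N(1)] by simp
  have a: "absv (a n) \<le> eps * rate N ^ n" if "n > 0" for n using a_bounds(1)[OF N that] .
  have a': "absv (a' n) \<le> eps * rate N ^ n" if "n > 0" for n
    using inverse_coeffs_bound[OF inv d_pos _ _ _ a that] eps_pos eps_less_1 r by simp
  have weak: "eps * rate N ^ n \<le> rate N ^ n" for n
    using eps_less_1 eps_pos r by simp
  have no_smaller: False if t: "0 < t" "t < rate N" "\<And>n. n > 0 \<Longrightarrow> absv (a n) \<le> t ^ n" for t
  proof -
    \<comment> \<open>The degrees \<open>p ^ j * d ^ N\<close>, where \<open>a\<close> attains its
      bound, are at least \<open>j\<close>; there the geometric gain of \<open>t\<close> over
      \<open>rate N\<close> beats the constant \<open>eps\<close>.\<close>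
    obtain j where j: "(t / rate N) ^ j < eps"
      using real_arch_pow_inv[of eps "t / rate N"] eps_pos t r by auto
    define n where "n = p ^ j * d ^ N"
    have "j < p ^ j" using p_gt_1 by (simp add: power_gt_expt)
    also have "p ^ j \<le> n" using d_pos by (simp add: n_def)
    finally have n: "j \<le> n" "n > 0" by auto
    have "eps * rate N ^ n \<le> t ^ n" using a_bounds(2)[OF N, of j] t(3)[OF n(2)] by (simp add: n_def)
    hence "eps \<le> (t / rate N) ^ n" using r by (simp add: power_divide pos_le_divide_eq)
    also have "\<dots> \<le> (t / rate N) ^ j" using n t r by (intro power_decreasing) auto
    finally show False using j by simp
  qed
  show "radius_pow absv a = ereal (rate N)"
  proof (rule antisym)
    show "radius_pow absv a \<le> ereal (rate N)"
      using radius_pow_le[OF r] a weak order_trans by blast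
    show "ereal (rate N) \<le> radius_pow absv a"
    proof (rule ccontr)
      assume "\<not> ereal (rate N) \<le> radius_pow absv a"
      then obtain t where "0 < t" "t < rate N" "\<And>n. n > 0 \<Longrightarrow> absv (a n) \<le> t ^ n"
        using radius_pow_less[OF _ r eps_pos eps_less_1 a] by (metis not_le)
      thus False by (rule no_smaller)
    qed
  qed
  show "radius_pow absv a' = ereal (rate N)"
  proof (rule antisym)
    show "radius_pow absv a' \<le> ereal (rate N)"
      using radius_pow_le[OF r] a' weak order_trans by blast
    show "ereal (rate N) \<le> radius_pow absv a'"
    proof (rule ccontr)
      assume "\<not> ereal (rate N) \<le> radius_pow absv a'"
      then obtain t where t: "0 < t" "t < rate N" "\<And>n. n > 0 \<Longrightarrow> absv (a' n) \<le> t ^ n"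
        using radius_pow_less[OF _ r eps_pos eps_less_1 a'] by (metis not_le)
      \<comment> \<open>The inverse relation is symmetric and \<open>C = 1\<close> is admissible, so
        a smaller rate for \<open>a'\<close> passes back to \<open>a\<close>.\<close>
      have "absv (a n) \<le> t ^ n" if "n > 0" for n
        using inverse_coeffs_bound[OF inverse_coeffs_commute[OF inv] d_pos, of 1 t n] t that by simp
      thus False using t by (intro no_smaller)
    qed
  qed
qed

end

section \<open>From the conditions on the valuation of \<open>c\<close> to the signs of the
  intercepts\<close>

theorem theorem1p2:
  fixes absv :: "'a::field_char_0 \<Rightarrow> real"
    and p d N :: nat and c :: 'a and a a' :: "nat \<Rightarrow> 'a"
  assumes Cp: "Cp_like p absv"
    and d2: "d \<ge> 2"
    and a: "bottcher_coeffs d c a"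
    and a': "inverse_coeffs d a a'"
    and cond: "(N = 0 \<and> p dvd d \<and>
                vp p absv c < vp p absv (of_nat d)
                  + ereal (real (multiplicity p (fact (d - 1))) / real (d - 1)))
             \<or> (N \<ge> 1 \<and> (\<exists>k. d = p ^ k) \<and>
                ereal (real N) * vp p absv (of_nat d)
                  + ereal (real (multiplicity p (fact (d - 1))) / real (d - 1)) < vp p absv c \<and>
                vp p absv c < ereal (real (N + 1)) * vp p absv (of_nat d)
                  + ereal (real (multiplicity p (fact (d - 1))) / real (d - 1)))"
  defines "r \<equiv> (absv (c / of_nat d ^ (N + 1)) * real p powr (1 / (real p - 1)))
                 powr (1 / real d ^ N)"
  shows "r > 1
     \<and> radius_pow absv a = ereal r
     \<and> radius_pow absv a' = ereal r
     \<and> (\<exists>f. (\<forall>z\<in>disk_inf absv (r powr (1 / real d)).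
               abs_sums absv (\<lambda>n. a (Suc n) * z powi (- int ((Suc n) * d))) (f z / z - 1))
           \<and> bij_betw f (disk_inf absv (r powr (1 / real d))) (disk_inf absv (r powr (1 / real d)))
           \<and> (\<forall>z\<in>disk_inf absv (r powr (1 / real d)). \<forall>w\<in>disk_inf absv (r powr (1 / real d)).
                absv (f z - f w) = absv (z - w)))"
proof -
  note Cp' = Cp[unfolded Cp_like_def]
  interpret nonarch_abs absv by (rule nonarch_abs.intro) (use Cp' in simp_all)
  interpret complete_nonarch_abs absv by unfold_locales (use Cp' in simp)
  interpret padic_abs absv p by unfold_locales (use Cp' in simp_all)
  have d_nz: "(of_nat d :: 'a) \<noteq> 0" using d2 by simp
  \<comment> \<open>For \<open>N = 0\<close> the factor \<open>real (N + 1)\<close> is 1, so both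
    conditions contain this bound.\<close>
  have upper: "vp p absv c < ereal (real (N + 1)) * vp p absv (of_nat d)
                  + ereal (real (multiplicity p (fact (d - 1))) / real (d - 1))"
    using cond by auto
  \<comment> \<open>The valuation of 0 is infinite, while the right-hand side of
    \<open>upper\<close> is finite.\<close>
  have c: "c \<noteq> 0" using upper d_nz by (auto simp: vp_def)
  have p_dvd: "p dvd d"
  proof (cases "N = 0")
    case False
    then obtain k where "d = p ^ k" using cond by auto
    thus ?thesis using d2 by (cases k) auto
  qed (use cond in auto)
  interpret boettcher absv p d c a
    using d2 p_dvd c a by unfold_locales
  have vp_c: "vp p absv c = ereal (- log p (absv c))" using c by (simp add: vp_def)
  have vp_d: "vp p absv (of_nat d) = ereal v" using d_nz by (simp add: vp_def v_def)
  define e where "e = real (multiplicity p (fact (d - 1))) / real (d - 1)"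
  have "- log p (absv c) < real (N + 1) * v + e"
    using upper unfolding vp_c vp_d e_def[symmetric] by simp
  moreover have "e \<le> 1 / (real p - 1) - v / (real d - 1)"
    unfolding e_def by (rule fact_exponent_le)
  ultimately have pos: "intercept N > 0" unfolding intercept_eq by argo
  have neg: "intercept (N - 1) < 0" if N: "N > 0"
  proof -
    obtain k where "d = p ^ k" and "real N * v + e < - log p (absv c)"
      using cond N unfolding vp_c vp_d e_def[symmetric] by auto
    moreover from this(1) have "e = 1 / (real p - 1) - v / (real d - 1)"
      unfolding e_def by (rule fact_exponent_eq)
    ultimately show ?thesis using N unfolding intercept_eq by simp
  qed
  have r: "r = rate N" unfolding r_def rate_eq ..
  have "rate N > 0" using rate_gt_1[OF pos] by simp
  from lacunary_series_isometry[OF d_pos eps_pos eps_less_1 this a_bounds(1)[OF pos neg]]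
    radius_pow_eq[OF pos neg a'] rate_gt_1[OF pos]
  show ?thesis unfolding r by blast
qed

end
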